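(* In the setting with common parameters described in the context, suppose that (1) $\mathbf Q=\gamma\mathbf X'\mathbf X$ for some $\gamma>0$; (2) for some fixed $b>0$ (the same for all models) the posterior means of $\boldsymbol\beta_{\mathbf l}$ are of the form $\widetilde{\boldsymbol\beta}_{\mathbf l}=b(\mathbf X_{\mathbf l}'\mathbf Q_{(1)}\mathbf X_{\mathbf l})^{-1}\mathbf X_{\mathbf l}'\mathbf Q_{(1)}\mathbf y$; (3) $\pi_{\mathbf l}(\boldsymbol\beta_{(1)},\boldsymbol\beta_{\mathbf l}|\sigma)=\pi_{\mathbf l}(\boldsymbol\beta_{\mathbf l}|\sigma)$, i.e. the prior density for $\boldsymbol\beta_{(1)}$ in each model is constant; and that the models under consideration are the nested sequence $M_{\mathbf l(j)}$, $j=0,\dots,k_2$, where $\mathbf l(j)=(1,\dots,1,0,\dots,0)\in\{0,1\}^{k_2}$ has $j$ ones followed by $k_2-j$ zeroes. Then the best predictive model is the median probability model, given either by $M_{\mathbf l^*}$ with $l_i^*=1$ if $p_i\ge\frac12$ and $l_i^*=0$ otherwise, or by $M_{\mathbf l(j^* )}$ with $j^*$ such that $$\sum_{i=0}^{j^*-1}P(M_{\mathbf l(i)}|\mathbf y)<\tfrac12\quad\text{and}\quad\sum_{i=0}^{j^*}P(M_{\mathbf l(i)}|\mathbf y)\ge\tfrac12 .$$ (That is, the model given by either description minimizes $R$ over the sequence.)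
   Context: Setting with common parameters. The full model is $\mathbf y=\mathbf X\boldsymbol\beta+\boldsymbol\varepsilon$, with $\mathbf y\in\mathbb R^n$ observed, $\mathbf X=(\mathbf X_{(1)}\ \mathbf X_{(2)})$ an $n\times k$ ($k<n$) matrix of full rank, $\mathbf X_{(1)}$ being $n\times k_1$ and $\mathbf X_{(2)}$ being $n\times k_2$, $k_1+k_2=k$, and $\boldsymbol\varepsilon$ having independent $N(0,\sigma^2)$ coordinates ($\sigma^2$ known or unknown). All models contain the common parameters $\boldsymbol\beta_{(1)}=(\beta_1,\dots,\beta_{k_1})'$. Models are indexed by $\mathbf l\in\{0,1\}^{k_2}$, recording which of the remaining (noncommon) variables are included: $M_{\mathbf l}$ is $\mathbf y=\mathbf X_{(1)}\boldsymbol\beta_{(1)}+\mathbf X_{\mathbf l}\boldsymbol\beta_{\mathbf l}+\boldsymbol\varepsilon$, where $\mathbf X_{\mathbf l}$ consists of the columns $i$ of $\mathbf X_{(2)}$ with $l_i=1$. With $k_{\mathbf l}=\sum_i l_i$, $\mathbf H_{\mathbf l}$ is the $k_2\times k_{\mathbf l}$ matrix whose $(i,j)$ entry is $1$ if $l_i=1$ and $j=\sum_{r=1}^i l_r$, and $0$ otherwise, so $\mathbf X_{\mathbf l}=\mathbf X_{(2)}\mathbf H_{\mathbf l}$. Put $$\mathbf Q_{(1)}=\mathbf I-\mathbf X_{(1)}(\mathbf X_{(1)}'\mathbf X_{(1)})^{-1}\mathbf X_{(1)}'.$$ Posterior inputs: for each model under consideration a posterior probability $p_{\mathbf l}=P(M_{\mathbf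 l}|\mathbf y)\ge0$ with $\sum_{\mathbf l}p_{\mathbf l}=1$ (sums over $\mathbf l$ are over the models under consideration), and a posterior distribution $\pi_{\mathbf l}(\boldsymbol\beta_{(1)},\boldsymbol\beta_{\mathbf l},\sigma|\mathbf y)$ obtained by Bayes' theorem within $M_{\mathbf l}$ from the normal likelihood and the (possibly improper) prior $\pi_{\mathbf l}(\boldsymbol\beta_{(1)},\boldsymbol\beta_{\mathbf l}|\sigma)$, combined with a prior on $\sigma$ if $\sigma$ is unknown; it is proper with posterior means $\widetilde{\boldsymbol\beta}_{(1),\mathbf l}$ of $\boldsymbol\beta_{(1)}$ and $\widetilde{\boldsymbol\beta}_{\mathbf l}$ of $\boldsymbol\beta_{\mathbf l}$. (The $p_{\mathbf l}$ may be determined separately from these posteriors.) For $\mathbf l=\mathbf 0$ there is no $\boldsymbol\beta_{\mathbf l}$ and the terms involving it are zero. Prediction: for a future covariate row vector $\mathbf x^*=(\mathbf x^*_{(1)},\mathbf x^*_{(2)})$, random with $\mathbf Q=\mathbf E[(\mathbf x^* )'(\mathbf x^* )]$ existing and positive definite, the future $y^*=\mathbf x^*\boldsymbol\beta+\varepsilon$ is predicted under squared error loss; the predictor under $M_{\mathbf l}$ is $\widehat y^*_{\mathbf l}=\mathbf x^*_{(1)}\widetilde{\boldsymbol\beta}_{(1),\mathbf l}+\mathbf x^*_{(2)}\mathbf H_{\mathbf l}\widetilde{\boldsymbol\beta}_{\mathbf l}$, and $\bar y^*=\sum_{\mathbf l}p_{\mathbf l}\widehat y^*_{\mathbf l}$.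 The best predictive model is the model under consideration minimizing $R(M_{\mathbf l})=\mathbf E^{\mathbf x^*}[(\widehat y^*_{\mathbf l}-\bar y^* )^2]$ (equivalently, minimizing the posterior expected predictive squared error loss, which differs from $R(M_{\mathbf l})$ by a constant not depending on $\mathbf l$). The posterior inclusion probability of noncommon variable $i$ is $p_i=\sum_{\mathbf l:\,l_i=1}p_{\mathbf l}$ (common variables are in every model). The two descriptions of the median probability model can differ only when some partial sum of the posterior model probabilities equals exactly $\frac12$. *)

theory Defs
  imports
    "HOL-Probability.Probability"
    "Jordan_Normal_Form.DL_Rank"
    "Jordan_Normal_Form.Gauss_Jordan_Elimination"
begin

unbundle no inner_syntax and no vec_syntax
hide_const (open) Finite_Cartesian_Product.vec Finite_Cartesian_Product.mat Determinants.det

definition append_cols :: "real mat \<Rightarrow> real mat \<Rightarrow> real mat" where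
  "append_cols A B = mat (dim_row A) (dim_col A + dim_col B)
     (\<lambda>(i, j). if j < dim_col A then A $$ (i, j) else B $$ (i, j - dim_col A))"

text \<open>Only meant for invertible arguments, for which \<^const>\<open>mat_inverse\<close> returns \<^const>\<open>Some\<close>.
  This includes the \<open>0 \<times> 0\<close> matrix, which occurs for the null model.\<close>

definition inv_mat :: "real mat \<Rightarrow> real mat" where
  "inv_mat A = the (mat_inverse A)"

definition positive_definite :: "real mat \<Rightarrow> bool" where
  "positive_definite A \<longleftrightarrow> square_mat A \<and> A\<^sup>T = A \<and>
     (\<forall>v \<in> carrier_vec (dim_row A). v \<noteq> 0\<^sub>v (dim_row A) \<longrightarrow> v \<bullet> (A *\<^sub>v v) > 0)"

definition Q1_mat :: "real mat \<Rightarrow> real mat" where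
  "Q1_mat X1 = 1\<^sub>m (dim_row X1) - X1 * inv_mat (X1\<^sup>T * X1) * X1\<^sup>T"

text \<open>A model is a 0-1 vector \<open>l\<close> of length \<open>k2\<close>. All indices start at 0, which accounts for
  the \<open>Suc j\<close> below.\<close>

definition model_size :: "nat vec \<Rightarrow> nat" where
  "model_size l = (\<Sum>i<dim_vec l. l $ i)"

definition H_mat :: "nat vec \<Rightarrow> real mat" where
  "H_mat l = mat (dim_vec l) (model_size l)
     (\<lambda>(i, j). if l $ i = 1 \<and> Suc j = (\<Sum>r\<le>i. l $ r) then 1 else 0)"

definition nested_model :: "nat \<Rightarrow> nat \<Rightarrow> nat vec" where
  "nested_model k2 j = vec k2 (\<lambda>i. if i < j then 1 else 0)"

definition nested_models :: "nat \<Rightarrow> nat vec set" where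
  "nested_models k2 = nested_model k2 ` {0..k2}"

text \<open>Within a model with design \<open>(X1, Xl)\<close> the parameter is a triple \<open>(b1, bl, s)\<close> of the common
  coefficients, the noncommon coefficients and the standard deviation. The prior consists of a
  density \<open>\<pi> b1 bl s\<close> of the coefficients given \<open>s\<close>, with respect to Lebesgue measure and possibly
  improper, and of a measure \<open>\<nu>\<close> for \<open>s\<close>, also possibly improper. A known standard deviation
  \<open>s0\<close> is the case \<open>\<nu> = return borel s0\<close>. For measure-theoretic purposes the coefficient vectors
  are represented as functions in a finite product of copies of \<open>lborel\<close>; the empty product is a
  one-point space, so in the null model there is no integration over \<open>bl\<close>.\<close>

type_synonym param = "(nat \<Rightarrow> real) \<times> (nat \<Rightarrow> real) \<times> real"
type_synonym coeff_prior = "real vec \<Rightarrow> real vec \<Rightarrow> real \<Rightarrow> real"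

definition param_measure :: "nat \<Rightarrow> nat \<Rightarrow> real measure \<Rightarrow> param measure" where
  "param_measure k1 kl \<nu> = (\<Pi>\<^sub>M i\<in>{..<k1}. lborel) \<Otimes>\<^sub>M (\<Pi>\<^sub>M i\<in>{..<kl}. lborel) \<Otimes>\<^sub>M \<nu>"

definition valid_prior :: "nat \<Rightarrow> nat \<Rightarrow> coeff_prior \<Rightarrow> real measure \<Rightarrow> bool" where
  "valid_prior k1 kl \<pi> \<nu> \<longleftrightarrow>
     sets \<nu> = sets borel \<and> sigma_finite_measure \<nu> \<and> emeasure \<nu> {..0} = 0 \<and>
     (\<lambda>(b1, bl, s). \<pi> (vec k1 b1) (vec kl bl) s) \<in> borel_measurable (param_measure k1 kl \<nu>) \<and>
     (\<forall>b1 \<in> carrier_vec k1. \<forall>bl \<in> carrier_vec kl. \<forall>s>0. \<pi> b1 bl s \<ge> 0)"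

definition likelihood ::
    "real mat \<Rightarrow> real mat \<Rightarrow> real vec \<Rightarrow> real vec \<Rightarrow> real vec \<Rightarrow> real \<Rightarrow> real" where
  "likelihood X1 Xl y b1 bl s =
     (\<Prod>i<dim_vec y. normal_density ((X1 *\<^sub>v b1 + Xl *\<^sub>v bl) $ i) s (y $ i))"

definition prior_times_likelihood ::
    "real mat \<Rightarrow> real mat \<Rightarrow> real vec \<Rightarrow> coeff_prior \<Rightarrow> param \<Rightarrow> ennreal" where
  "prior_times_likelihood X1 Xl y \<pi> = (\<lambda>(b1, bl, s).
     let b1' = vec (dim_col X1) b1; bl' = vec (dim_col Xl) bl
     in ennreal (\<pi> b1' bl' s * likelihood X1 Xl y b1' bl' s))"

definition marginal_likelihood ::
    "real mat \<Rightarrow> real mat \<Rightarrow> real vec \<Rightarrow> coeff_prior \<Rightarrow> real measure \<Rightarrow> ennreal" where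
  "marginal_likelihood X1 Xl y \<pi> \<nu> =
     (\<integral>\<^sup>+ \<theta>. prior_times_likelihood X1 Xl y \<pi> \<theta> \<partial>param_measure (dim_col X1) (dim_col Xl) \<nu>)"

definition posterior ::
    "real mat \<Rightarrow> real mat \<Rightarrow> real vec \<Rightarrow> coeff_prior \<Rightarrow> real measure \<Rightarrow> param measure" where
  "posterior X1 Xl y \<pi> \<nu> = density (param_measure (dim_col X1) (dim_col Xl) \<nu>)
     (\<lambda>\<theta>. prior_times_likelihood X1 Xl y \<pi> \<theta> / marginal_likelihood X1 Xl y \<pi> \<nu>)"

definition proper_posterior_with_means ::
    "real mat \<Rightarrow> real mat \<Rightarrow> real vec \<Rightarrow> coeff_prior \<Rightarrow> real measure \<Rightarrow> bool" where
  "proper_posterior_with_means X1 Xl y \<pi> \<nu> \<longleftrightarrow>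
     0 < marginal_likelihood X1 Xl y \<pi> \<nu> \<and> marginal_likelihood X1 Xl y \<pi> \<nu> < \<infinity> \<and>
     (\<forall>i<dim_col X1. integrable (posterior X1 Xl y \<pi> \<nu>) (\<lambda>(b1, bl, s). b1 i)) \<and>
     (\<forall>i<dim_col Xl. integrable (posterior X1 Xl y \<pi> \<nu>) (\<lambda>(b1, bl, s). bl i))"

definition posterior_mean_common ::
    "real mat \<Rightarrow> real mat \<Rightarrow> real vec \<Rightarrow> coeff_prior \<Rightarrow> real measure \<Rightarrow> real vec" where
  "posterior_mean_common X1 Xl y \<pi> \<nu> =
     vec (dim_col X1) (\<lambda>i. \<integral>(b1, bl, s). b1 i \<partial>posterior X1 Xl y \<pi> \<nu>)"

definition posterior_mean_noncommon ::
    "real mat \<Rightarrow> real mat \<Rightarrow> real vec \<Rightarrow> coeff_prior \<Rightarrow> real measure \<Rightarrow> real vec" where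
  "posterior_mean_noncommon X1 Xl y \<pi> \<nu> =
     vec (dim_col Xl) (\<lambda>i. \<integral>(b1, bl, s). bl i \<partial>posterior X1 Xl y \<pi> \<nu>)"

definition random_vec :: "'w measure \<Rightarrow> nat \<Rightarrow> ('w \<Rightarrow> real vec) \<Rightarrow> bool" where
  "random_vec P k x \<longleftrightarrow> (\<forall>\<omega> \<in> space P. x \<omega> \<in> carrier_vec k) \<and>
     (\<forall>i<k. (\<lambda>\<omega>. x \<omega> $ i) \<in> borel_measurable P)"

definition has_second_moments :: "'w measure \<Rightarrow> nat \<Rightarrow> ('w \<Rightarrow> real vec) \<Rightarrow> bool" where
  "has_second_moments P k x \<longleftrightarrow> (\<forall>i<k. \<forall>j<k. integrable P (\<lambda>\<omega>. x \<omega> $ i * x \<omega> $ j))"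

definition second_moment_mat :: "'w measure \<Rightarrow> nat \<Rightarrow> ('w \<Rightarrow> real vec) \<Rightarrow> real mat" where
  "second_moment_mat P k x = mat k k (\<lambda>(i, j). \<integral>\<omega>. x \<omega> $ i * x \<omega> $ j \<partial>P)"

text \<open>Here \<open>bc l\<close> and \<open>bn l\<close> are the estimates of the common and of the noncommon coefficients
  in model \<open>l\<close>.\<close>

definition predictor ::
    "('w \<Rightarrow> real vec) \<Rightarrow> ('w \<Rightarrow> real vec) \<Rightarrow> (nat vec \<Rightarrow> real vec) \<Rightarrow> (nat vec \<Rightarrow> real vec)
     \<Rightarrow> nat vec \<Rightarrow> 'w \<Rightarrow> real" where
  "predictor x1 x2 bc bn l \<omega> = x1 \<omega> \<bullet> bc l + x2 \<omega> \<bullet> (H_mat l *\<^sub>v bn l)"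

definition predictive_risk ::
    "'w measure \<Rightarrow> nat vec set \<Rightarrow> (nat vec \<Rightarrow> real) \<Rightarrow> (nat vec \<Rightarrow> 'w \<Rightarrow> real) \<Rightarrow> nat vec \<Rightarrow> real" where
  "predictive_risk P Ms p yhat l = (\<integral>\<omega>. (yhat l \<omega> - (\<Sum>l'\<in>Ms. p l' * yhat l' \<omega>))\<^sup>2 \<partial>P)"

definition best_predictive_model :: "(nat vec \<Rightarrow> real) \<Rightarrow> nat vec set \<Rightarrow> nat vec \<Rightarrow> bool" where
  "best_predictive_model R Ms l \<longleftrightarrow> is_arg_min R (\<lambda>l'. l' \<in> Ms) l"

definition inclusion_prob :: "nat vec set \<Rightarrow> (nat vec \<Rightarrow> real) \<Rightarrow> nat \<Rightarrow> real" where
  "inclusion_prob Ms p i = (\<Sum>l | l \<in> Ms \<and> l $ i = 1. p l)"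

definition median_prob_model :: "nat \<Rightarrow> nat vec set \<Rightarrow> (nat vec \<Rightarrow> real) \<Rightarrow> nat vec" where
  "median_prob_model k2 Ms p = vec k2 (\<lambda>i. if inclusion_prob Ms p i \<ge> 1/2 then 1 else 0)"

definition nested_median_index :: "nat \<Rightarrow> (nat vec \<Rightarrow> real) \<Rightarrow> nat \<Rightarrow> bool" where
  "nested_median_index k2 p j \<longleftrightarrow> j \<le> k2 \<and>
     (\<Sum>i<j. p (nested_model k2 i)) < 1/2 \<and> (\<Sum>i\<le>j. p (nested_model k2 i)) \<ge> 1/2"

end

theory Submission
  imports Defs
begin

text \<open>Write \<open>f j\<close> for the prediction of the model with the first \<open>j\<close> noncommon variables and \<open>\<beta> j\<close>
for its full vector of estimated coefficients, padded with zeroes. Since the second moment matrix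
of the covariates is \<open>\<gamma> X\<^sup>T X\<close>, products of predictions have expectation
\<open>E (f i * f j) = \<gamma> (X \<beta> i) \<bullet> (X \<beta> j)\<close>, so the comparison of the models takes place among the fitted
vectors \<open>X \<beta> j\<close>.

Under a prior that is constant in the common coefficients, the posterior mean of these is the least
squares fit to the residual \<open>y - X\<^sub>l \<beta>\<^sub>l\<close>, where \<open>\<beta>\<^sub>l\<close> is the posterior mean of the noncommon
coefficients (\<open>posterior_mean_common_flat_prior\<close>). The reason is a symmetry: reflecting the common
coefficients, for fixed noncommon ones, about their least squares value preserves Lebesgue measure
and the likelihood, hence the posterior. The fitted vector is then the projection of \<open>y\<close> onto the
common column space plus \<open>b\<close> times the projection of \<open>y\<close> onto the column space of
\<open>Q\<^sub>1 X\<^sub>l\<close>. These column spaces increase along the nested sequence, so that the inner product of the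
\<open>i\<close>-th and the \<open>j\<close>-th fitted vector depends on the smaller of the two indices only
(\<open>fitted_values_inner_nested\<close>): \<open>E (f i * f j) = g (min i j)\<close>.

In other words the predictions have orthogonal increments. For any such sequence, \<open>g\<close> is nondecreasing,
and expanding the square shows that passing from model \<open>m\<close> to model \<open>m + 1\<close> changes the risk by
\<open>(g (m + 1) - g m) * (1 - 2 T m)\<close>, where \<open>T m\<close> is the total probability of the models larger than
\<open>m\<close> (\<open>orthogonal_increments_risk_step\<close>), which is the inclusion probability of the next variable.
Because \<open>T\<close> is nonincreasing, the risk falls as long as \<open>T m \<ge> 1/2\<close> and rises once
\<open>T m \<le> 1/2\<close>; it is minimal where \<open>T\<close> crosses \<open>1/2\<close>, and both descriptions of the median
probability model pick such a point.\<close>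

section \<open>Predictions with orthogonal increments\<close>

text \<open>The hypothesis on the second moments says that the increments of \<open>f\<close> are orthogonal. Expanding the
square, the risk of \<open>f j\<close> is \<open>g j - 2 (\<Sum>i\<le>k. p i * g (min i j))\<close> plus a constant, and
raising \<open>j\<close> from \<open>m\<close> to \<open>m + 1\<close> affects only the terms of the sum with \<open>i > m\<close>.\<close>

lemma orthogonal_increments_risk_step:
  fixes f :: "nat \<Rightarrow> 'w \<Rightarrow> real" and g p :: "nat \<Rightarrow> real"
  assumes int: "\<And>i j. i \<le> k \<Longrightarrow> j \<le> k \<Longrightarrow> integrable P (\<lambda>\<omega>. f i \<omega> * f j \<omega>)"
    and moment: "\<And>i j. i \<le> j \<Longrightarrow> j \<le> k \<Longrightarrow> (\<integral>\<omega>. f i \<omega> * f j \<omega> \<partial>P) = g i"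
    and m: "m < k"
  defines "risk \<equiv> \<lambda>j. \<integral>\<omega>. (f j \<omega> - (\<Sum>i\<le>k. p i * f i \<omega>))\<^sup>2 \<partial>P"
  shows "risk (Suc m) - risk m = (g (Suc m) - g m) * (1 - 2 * (\<Sum>i\<in>{m<..k}. p i))"
proof -
  define G where "G j = (\<Sum>i\<le>k. p i * (\<integral>\<omega>. f i \<omega> * f j \<omega> \<partial>P))" for j
  let ?S = "\<lambda>\<omega>. \<Sum>i\<le>k. p i * f i \<omega>"
  have int_cross: "integrable P (\<lambda>\<omega>. ?S \<omega> * f j \<omega>)" if "j \<le> k" for j
    unfolding sum_distrib_right mult.assoc
    by (intro Bochner_Integration.integrable_sum integrable_mult_right int) (use that in auto)
  have cross: "(\<integral>\<omega>. ?S \<omega> * f j \<omega> \<partial>P) = G j" if "j \<le> k" for j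
    unfolding sum_distrib_right mult.assoc G_def
    by (subst Bochner_Integration.integral_sum) (auto intro!: integrable_mult_right int that)
  have int_sq: "integrable P (\<lambda>\<omega>. ?S \<omega> * ?S \<omega>)"
    unfolding sum_distrib_left
    by (intro Bochner_Integration.integrable_sum, subst mult.left_commute)
      (auto intro!: integrable_mult_right int_cross)
  have risk: "risk j = g j - 2 * G j + (\<integral>\<omega>. ?S \<omega> * ?S \<omega> \<partial>P)" if "j \<le> k" for j
  proof -
    have "risk j = (\<integral>\<omega>. f j \<omega> * f j \<omega> - 2 * (?S \<omega> * f j \<omega>) + ?S \<omega> * ?S \<omega> \<partial>P)"
      unfolding risk_def by (intro Bochner_Integration.integral_cong) (auto simp: power2_eq_square algebra_simps)
    also have "\<dots> = (\<integral>\<omega>. f j \<omega> * f j \<omega> \<partial>P) - 2 * (\<integral>\<omega>. ?S \<omega> * f j \<omega> \<partial>P) + (\<integral>\<omega>. ?S \<omega> * ?S \<omega> \<partial>P)"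
      using int[OF that that] int_cross[OF that] int_sq by simp
    finally show ?thesis using moment[of j j] cross that by simp
  qed
  have moment_min: "(\<integral>\<omega>. f i \<omega> * f j \<omega> \<partial>P) = g (min i j)" if "i \<le> k" "j \<le> k" for i j
    using moment[of i j] moment[of j i] that by (cases "i \<le> j") (auto simp: mult.commute min_def)
  have "G (Suc m) - G m = (\<Sum>i\<le>k. p i * (g (min i (Suc m)) - g (min i m)))"
    unfolding G_def using m by (simp add: moment_min sum_subtractf right_diff_distrib)
  also have "\<dots> = (\<Sum>i\<in>{m<..k}. p i * (g (Suc m) - g m))"
    by (intro sum.mono_neutral_cong_right) (auto simp: min_def le_Suc_eq)
  finally have "G (Suc m) - G m = (\<Sum>i\<in>{m<..k}. p i) * (g (Suc m) - g m)"
    by (simp add: sum_distrib_right)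
  then show ?thesis using risk[of m] risk[of "Suc m"] m by (simp add: algebra_simps)
qed

text \<open>The increment of \<open>g\<close> is the second moment of the increment of \<open>f\<close>.\<close>

lemma orthogonal_increments_variance_mono:
  fixes f :: "nat \<Rightarrow> 'w \<Rightarrow> real" and g :: "nat \<Rightarrow> real"
  assumes int: "\<And>i j. i \<le> k \<Longrightarrow> j \<le> k \<Longrightarrow> integrable P (\<lambda>\<omega>. f i \<omega> * f j \<omega>)"
    and moment: "\<And>i j. i \<le> j \<Longrightarrow> j \<le> k \<Longrightarrow> (\<integral>\<omega>. f i \<omega> * f j \<omega> \<partial>P) = g i"
    and m: "m < k"
  shows "g m \<le> g (Suc m)"
proof -
  have "0 \<le> (\<integral>\<omega>. (f (Suc m) \<omega> - f m \<omega>)\<^sup>2 \<partial>P)" by simp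
  also have "\<dots> = (\<integral>\<omega>. f (Suc m) \<omega> * f (Suc m) \<omega> - 2 * (f m \<omega> * f (Suc m) \<omega>) + f m \<omega> * f m \<omega> \<partial>P)"
    by (intro Bochner_Integration.integral_cong) (auto simp: power2_eq_square algebra_simps)
  also have "\<dots> = g (Suc m) - g m"
    using m by (simp add: int moment)
  finally show ?thesis by simp
qed

lemma valley_minimum:
  fixes r :: "nat \<Rightarrow> real"
  assumes dec: "\<And>i. i < j \<Longrightarrow> r (Suc i) \<le> r i"
    and inc: "\<And>i. j \<le> i \<Longrightarrow> i < k \<Longrightarrow> r i \<le> r (Suc i)"
    and a: "a \<le> k"
  shows "r j \<le> r a"
proof (cases "a \<le> j")
  case True
  then show ?thesis
    by (induction rule: inc_induct) (use dec in \<open>auto intro: order_trans\<close>)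
next
  case False
  then have "j \<le> a" by simp
  then show ?thesis using a
  proof (induction rule: dec_induct)
    case (step m) then show ?case using inc[of m] by simp
  qed simp
qed

text \<open>The risk step at \<open>m\<close> vanishes or has the sign of \<open>1/2 - (\<Sum>i\<in>{m<..k}. p i)\<close>, so an index at which the tail
sums cross \<open>1/2\<close> is the bottom of a valley.\<close>

lemma orthogonal_increments_risk_minimum:
  fixes f :: "nat \<Rightarrow> 'w \<Rightarrow> real" and g p :: "nat \<Rightarrow> real"
  assumes int: "\<And>i j. i \<le> k \<Longrightarrow> j \<le> k \<Longrightarrow> integrable P (\<lambda>\<omega>. f i \<omega> * f j \<omega>)"
    and moment: "\<And>i j. i \<le> j \<Longrightarrow> j \<le> k \<Longrightarrow> (\<integral>\<omega>. f i \<omega> * f j \<omega> \<partial>P) = g i"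
    and j: "j \<le> k"
      "\<And>i. i < j \<Longrightarrow> (\<Sum>m\<in>{i<..k}. p m) \<ge> 1/2"
      "\<And>i. j \<le> i \<Longrightarrow> i < k \<Longrightarrow> (\<Sum>m\<in>{i<..k}. p m) \<le> 1/2"
    and a: "a \<le> k"
  defines "risk \<equiv> \<lambda>j. \<integral>\<omega>. (f j \<omega> - (\<Sum>i\<le>k. p i * f i \<omega>))\<^sup>2 \<partial>P"
  shows "risk j \<le> risk a"
proof (rule valley_minimum[OF _ _ a])
  have step: "risk (Suc m) - risk m = (g (Suc m) - g m) * (1 - 2 * (\<Sum>i\<in>{m<..k}. p i))" if "m < k" for m
    unfolding risk_def by (rule orthogonal_increments_risk_step[where f = f and g = g, OF int moment that])
  have mono: "g m \<le> g (Suc m)" if "m < k" for m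
    by (rule orthogonal_increments_variance_mono[where f = f and g = g, OF int moment that])
  show "risk (Suc i) \<le> risk i" if "i < j" for i
  proof -
    have "(g (Suc i) - g i) * (1 - 2 * (\<Sum>m\<in>{i<..k}. p m)) \<le> 0"
      by (rule mult_nonneg_nonpos) (use mono[of i] j(1) j(2)[OF that] that in auto)
    then show ?thesis using step[of i] that j(1) by simp
  qed
  show "risk i \<le> risk (Suc i)" if "j \<le> i" "i < k" for i
  proof -
    have "0 \<le> (g (Suc i) - g i) * (1 - 2 * (\<Sum>m\<in>{i<..k}. p m))"
      by (rule mult_nonneg_nonneg) (use mono[of i] j(3)[OF that] that in auto)
    then show ?thesis using step[of i] that by simp
  qed
qed

section \<open>Matrices, Gram matrices and inverses\<close>

lemma mult_mat_vec_index_sum: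
  assumes "A \<in> carrier_mat nr nc" "v \<in> carrier_vec nc" "i < nr"
  shows "(A *\<^sub>v v) $ i = (\<Sum>j<nc. A $$ (i, j) * v $ j)"
  using assms by (auto simp: scalar_prod_def lessThan_atLeast0)

lemma scalar_prod_self_eq_0:
  fixes v :: "real vec"
  assumes "v \<in> carrier_vec n" "v \<bullet> v = 0"
  shows "v = 0\<^sub>v n"
  using assms by (intro eq_vecI) (auto simp: scalar_prod_def sum_nonneg_eq_0_iff)

lemma minus_vec_eq_0D:
  fixes u v :: "real vec"
  assumes "u \<in> carrier_vec n" "v \<in> carrier_vec n" and 0: "u - v = 0\<^sub>v n"
  shows "v = u"
proof (rule eq_vecI)
  fix i assume "i < dim_vec u"
  then show "v $ i = u $ i" using assms(1,2) arg_cong[OF 0, of "\<lambda>w. w $ i"] by simp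
qed (use assms in simp)

lemma scalar_prod_diff_diff:
  fixes e d :: "real vec"
  assumes "e \<in> carrier_vec n" "d \<in> carrier_vec n"
  shows "(e - d) \<bullet> (e - d) = e \<bullet> e - 2 * (e \<bullet> d) + d \<bullet> d"
proof -
  have ed: "e - d \<in> carrier_vec n" using assms by simp
  have "(e - d) \<bullet> (e - d) = e \<bullet> (e - d) - d \<bullet> (e - d)"
    by (rule minus_scalar_prod_distrib[OF assms ed])
  then show ?thesis
    using scalar_prod_minus_distrib[OF assms(1) assms] scalar_prod_minus_distrib[OF assms(2) assms]
      comm_scalar_prod[OF assms] by simp
qed

lemma smult_mat_mult_vec:
  fixes B :: "real mat"
  assumes "B \<in> carrier_mat m k" "w \<in> carrier_vec k"
  shows "(c \<cdot>\<^sub>m B) *\<^sub>v w = c \<cdot>\<^sub>v (B *\<^sub>v w)"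
  using assms by (intro eq_vecI) auto

text \<open>Full column rank is encoded as injectivity, the form in which positive definiteness of the Gram
matrix yields it.\<close>

definition full_column_rank :: "real mat \<Rightarrow> bool" where
  "full_column_rank A \<longleftrightarrow>
     (\<forall>v \<in> carrier_vec (dim_col A). A *\<^sub>v v = 0\<^sub>v (dim_row A) \<longrightarrow> v = 0\<^sub>v (dim_col A))"

lemma full_column_rankI:
  assumes "A \<in> carrier_mat n k"
    "\<And>v. v \<in> carrier_vec k \<Longrightarrow> A *\<^sub>v v = 0\<^sub>v n \<Longrightarrow> v = 0\<^sub>v k"
  shows "full_column_rank A"
  using assms by (auto simp: full_column_rank_def)

lemma full_column_rankD:
  assumes "full_column_rank A" "A \<in> carrier_mat n k" "v \<in> carrier_vec k" "A *\<^sub>v v = 0\<^sub>v n"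
  shows "v = 0\<^sub>v k"
  using assms by (auto simp: full_column_rank_def)

lemma inv_mat_full_rank:
  assumes A: "A \<in> carrier_mat k k"
    and inj: "full_column_rank A"
  shows "inv_mat A \<in> carrier_mat k k" "A * inv_mat A = 1\<^sub>m k"
proof -
  have "det A \<noteq> 0" using det_0_iff_vec_prod_zero_field[OF A] full_column_rankD[OF inj A] by auto
  then have "A \<in> Units (ring_mat TYPE(real) k ())" by (rule det_non_zero_imp_unit[OF A])
  then obtain B where "mat_inverse A = Some B"
    using mat_inverse(1)[OF A, of "()"] by (cases "mat_inverse A") auto
  then show "inv_mat A \<in> carrier_mat k k" "A * inv_mat A = 1\<^sub>m k"
    using mat_inverse(2)[OF A] by (auto simp: inv_mat_def)
qed

text \<open>\<open>A\<^sup>T A v = 0\<close> implies \<open>(A v) \<bullet> (A v) = (A\<^sup>T A v) \<bullet> v = 0\<close>.\<close>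

lemma full_column_rank_gram:
  fixes A :: "real mat"
  assumes A: "A \<in> carrier_mat n k"
    and inj: "full_column_rank A"
  shows "full_column_rank (A\<^sup>T * A)"
proof (rule full_column_rankI)
  show "A\<^sup>T * A \<in> carrier_mat k k" using A by auto
  fix v assume v: "v \<in> carrier_vec k" "(A\<^sup>T * A) *\<^sub>v v = 0\<^sub>v k"
  have Av: "A *\<^sub>v v \<in> carrier_vec n" using A v by auto
  have "(A *\<^sub>v v) \<bullet> (A *\<^sub>v v) = (A\<^sup>T *\<^sub>v (A *\<^sub>v v)) \<bullet> v"
    by (rule transpose_vec_mult_scalar[symmetric]) (use A v in auto)
  also have "A\<^sup>T *\<^sub>v (A *\<^sub>v v) = 0\<^sub>v k" using A v by simp
  finally have "(A *\<^sub>v v) \<bullet> (A *\<^sub>v v) = 0" using v by simp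
  then show "v = 0\<^sub>v k" using scalar_prod_self_eq_0[OF Av] full_column_rankD[OF inj A] v by simp
qed

lemma scaled_gram_bilinear:
  fixes A :: "real mat"
  assumes A: "A \<in> carrier_mat n k" and v: "v \<in> carrier_vec k" and w: "w \<in> carrier_vec k"
  shows "v \<bullet> ((c \<cdot>\<^sub>m (A\<^sup>T * A)) *\<^sub>v w) = c * ((A *\<^sub>v v) \<bullet> (A *\<^sub>v w))"
proof -
  have Av: "A *\<^sub>v v \<in> carrier_vec n" and Aw: "A *\<^sub>v w \<in> carrier_vec n" using A v w by auto
  have "(c \<cdot>\<^sub>m (A\<^sup>T * A)) *\<^sub>v w = c \<cdot>\<^sub>v ((A\<^sup>T * A) *\<^sub>v w)"
    by (rule smult_mat_mult_vec[of _ k k]) (use A w in auto)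
  also have "(A\<^sup>T * A) *\<^sub>v w = A\<^sup>T *\<^sub>v (A *\<^sub>v w)" using A w by simp
  finally have "v \<bullet> ((c \<cdot>\<^sub>m (A\<^sup>T * A)) *\<^sub>v w) = c * (v \<bullet> (A\<^sup>T *\<^sub>v (A *\<^sub>v w)))"
    using A v Aw by simp
  also have "v \<bullet> (A\<^sup>T *\<^sub>v (A *\<^sub>v w)) = (A\<^sup>T *\<^sub>v (A *\<^sub>v w)) \<bullet> v"
    by (rule comm_scalar_prod[of _ k]) (use A v Aw in auto)
  also have "\<dots> = (A *\<^sub>v w) \<bullet> (A *\<^sub>v v)" by (rule transpose_vec_mult_scalar[OF A v Aw])
  also have "\<dots> = (A *\<^sub>v v) \<bullet> (A *\<^sub>v w)" by (rule comm_scalar_prod[OF Aw Av])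
  finally show ?thesis .
qed

lemma append_cols_carrier:
  assumes "A \<in> carrier_mat n k" "B \<in> carrier_mat n m"
  shows "append_cols A B \<in> carrier_mat n (k + m)"
  using assms by (auto simp: append_cols_def)

lemma append_cols_mult_append_vec:
  assumes A: "A \<in> carrier_mat n k" and B: "B \<in> carrier_mat n m"
    and a: "a \<in> carrier_vec k" and c: "c \<in> carrier_vec m"
  shows "append_cols A B *\<^sub>v (a @\<^sub>v c) = A *\<^sub>v a + B *\<^sub>v c"
proof (rule eq_vecI)
  fix i assume "i < dim_vec (A *\<^sub>v a + B *\<^sub>v c)"
  then have i: "i < n" using B by simp
  have "row (append_cols A B) i = row A i @\<^sub>v row B i"
    using A B i by (intro eq_vecI) (auto simp: append_cols_def)
  then show "(append_cols A B *\<^sub>v (a @\<^sub>v c)) $ i = (A *\<^sub>v a + B *\<^sub>v c) $ i"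
    using A B a c i append_cols_carrier[OF A B] scalar_prod_append[of "row A i" k "row B i" m a c] by simp
qed (use A B in \<open>auto simp: append_cols_def\<close>)

section \<open>Nested models and their median\<close>

lemma model_size_nested: "j \<le> k2 \<Longrightarrow> model_size (nested_model k2 j) = j"
proof -
  assume j: "j \<le> k2"
  have "model_size (nested_model k2 j) = (\<Sum>i<k2. if i < j then 1 else 0)"
    by (simp add: model_size_def nested_model_def)
  also have "\<dots> = (\<Sum>i<j. 1)" by (rule sum.mono_neutral_cong_right) (use j in auto)
  finally show ?thesis by simp
qed

lemma H_mat_nested_carrier: "j \<le> k2 \<Longrightarrow> H_mat (nested_model k2 j) \<in> carrier_mat k2 j"
  by (simp add: H_mat_def model_size_nested) (simp add: nested_model_def)

text \<open>The matrix of a nested model pads a vector with zeroes, since the partial sums of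
\<open>(1, \<dots>, 1, 0, \<dots>, 0)\<close> count up to \<open>j\<close> and then stay there.\<close>

lemma H_mat_nested_mult:
  assumes j: "j \<le> k2" and v: "v \<in> carrier_vec j"
  shows "H_mat (nested_model k2 j) *\<^sub>v v = vec k2 (\<lambda>r. if r < j then v $ r else 0)"
proof (rule eq_vecI)
  fix r assume "r < dim_vec (vec k2 (\<lambda>r. if r < j then v $ r else 0))"
  then have r: "r < k2" by simp
  have entry: "H_mat (nested_model k2 j) $$ (r, c) = (if r = c then 1 else 0)" if c: "c < j" for c
  proof (cases "r < j")
    case True
    have "(\<Sum>i\<le>r. nested_model k2 j $ i) = (\<Sum>i\<le>r. 1)"
      by (rule sum.cong) (use r True in \<open>auto simp: nested_model_def\<close>)
    then show ?thesis using r c True j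
      by (auto simp: H_mat_def model_size_nested) (auto simp: nested_model_def)
  next
    case False
    then show ?thesis using r c j
      by (auto simp: H_mat_def model_size_nested) (auto simp: nested_model_def)
  qed
  have "(H_mat (nested_model k2 j) *\<^sub>v v) $ r = (\<Sum>c<j. H_mat (nested_model k2 j) $$ (r, c) * v $ c)"
    by (rule mult_mat_vec_index_sum[OF H_mat_nested_carrier[OF j] v r])
  also have "\<dots> = (\<Sum>c<j. if c = r then v $ c else 0)"
    by (rule sum.cong) (auto simp: entry)
  also have "\<dots> = (if r < j then v $ r else 0)" by simp
  finally show "(H_mat (nested_model k2 j) *\<^sub>v v) $ r = vec k2 (\<lambda>r. if r < j then v $ r else 0) $ r"
    using r by simp
qed (use H_mat_nested_carrier[OF j] in auto)

lemma H_mat_nested_injective: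
  assumes j: "j \<le> k2" and v: "v \<in> carrier_vec j" and 0: "H_mat (nested_model k2 j) *\<^sub>v v = 0\<^sub>v k2"
  shows "v = 0\<^sub>v j"
proof (rule eq_vecI)
  fix r assume "r < dim_vec (0\<^sub>v j :: real vec)"
  then show "v $ r = 0\<^sub>v j $ r"
    using arg_cong[OF 0, of "\<lambda>w. w $ r"] H_mat_nested_mult[OF j v] j by simp
qed (use v in simp)

lemma H_mat_nested_range_mono:
  assumes "i \<le> j" "j \<le> k2" "v \<in> carrier_vec i"
  obtains a where "a \<in> carrier_vec j"
    "H_mat (nested_model k2 i) *\<^sub>v v = H_mat (nested_model k2 j) *\<^sub>v a"
proof
  let ?a = "vec j (\<lambda>r. if r < i then v $ r else 0)"
  show a: "?a \<in> carrier_vec j" by simp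
  show "H_mat (nested_model k2 i) *\<^sub>v v = H_mat (nested_model k2 j) *\<^sub>v ?a"
    using assms by (subst H_mat_nested_mult[OF _ a], simp, subst H_mat_nested_mult) auto
qed

lemma inj_nested_model: "inj_on (nested_model k2) {..k2}"
  by (rule inj_on_inverseI[where g = model_size]) (simp add: model_size_nested)

lemma nested_models_eq: "nested_models k2 = nested_model k2 ` {..k2}"
  by (simp add: nested_models_def atMost_atLeast0)

lemma inclusion_prob_nested:
  assumes i: "i < k2"
  shows "inclusion_prob (nested_models k2) p i = (\<Sum>m\<in>{i<..k2}. p (nested_model k2 m))"
proof -
  have "{l \<in> nested_models k2. l $ i = 1} = nested_model k2 ` {i<..k2}"
    using i by (auto simp: nested_models_eq nested_model_def split: if_splits)
  then have "inclusion_prob (nested_models k2) p i = sum p (nested_model k2 ` {i<..k2})"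
    unfolding inclusion_prob_def by (rule arg_cong)
  also have "\<dots> = (\<Sum>m\<in>{i<..k2}. p (nested_model k2 m))"
    by (rule sum.reindex_cong[OF inj_on_subset[OF inj_nested_model]]) auto
  finally show ?thesis .
qed

text \<open>The inclusion probability of variable \<open>i\<close> is the tail sum over \<open>{i<..k2}\<close>, hence nonincreasing in
\<open>i\<close>, so the variables with inclusion probability at least \<open>1/2\<close> form an initial segment and the
median probability model belongs to the nested sequence.\<close>

lemma median_prob_model_nested:
  assumes nonneg: "\<And>l. l \<in> nested_models k2 \<Longrightarrow> p l \<ge> 0"
  shows "\<exists>j\<le>k2. median_prob_model k2 (nested_models k2) p = nested_model k2 j \<and>
    (\<forall>i<j. (\<Sum>m\<in>{i<..k2}. p (nested_model k2 m)) \<ge> 1/2) \<and>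
    (\<forall>i. j \<le> i \<and> i < k2 \<longrightarrow> (\<Sum>m\<in>{i<..k2}. p (nested_model k2 m)) < 1/2)"
proof -
  let ?T = "\<lambda>i. \<Sum>m\<in>{i<..k2}. p (nested_model k2 m)"
  have anti: "?T i' \<le> ?T i" if "i \<le> i'" for i i'
    by (rule sum_mono2) (use that nonneg in \<open>auto simp: nested_models_eq\<close>)
  define j where "j = (LEAST i. ?T i < 1/2)"
  have ex: "?T k2 < 1/2" by simp
  have T1: "?T i \<ge> 1/2" if "i < j" for i
    using not_less_Least[of i "\<lambda>i. ?T i < 1/2"] that unfolding j_def by simp
  have T2: "?T i < 1/2" if "j \<le> i" for i
    using LeastI[of "\<lambda>i. ?T i < 1/2", OF ex] anti[OF that] unfolding j_def by linarith
  have "j \<le> k2" unfolding j_def by (rule Least_le[of "\<lambda>i. ?T i < 1/2", OF ex])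
  moreover have "median_prob_model k2 (nested_models k2) p = nested_model k2 j"
  proof (rule eq_vecI)
    fix i assume "i < dim_vec (nested_model k2 j)"
    then have i: "i < k2" by (simp add: nested_model_def)
    show "median_prob_model k2 (nested_models k2) p $ i = nested_model k2 j $ i"
      using i T1[of i] T2[of i]
      by (cases "i < j") (auto simp: median_prob_model_def nested_model_def inclusion_prob_nested)
  qed (simp add: median_prob_model_def nested_model_def)
  ultimately show ?thesis using T1 T2 by blast
qed

lemma sum_tail_eq_diff:
  fixes q :: "nat \<Rightarrow> real"
  assumes "(\<Sum>i\<le>k. q i) = 1" "j \<le> k"
  shows "(\<Sum>i\<in>{j<..k}. q i) = 1 - (\<Sum>i\<le>j. q i)"
proof -
  have "{..k} = {..j} \<union> {j<..k}" using assms by auto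
  then have "(\<Sum>i\<le>k. q i) = (\<Sum>i\<le>j. q i) + (\<Sum>i\<in>{j<..k}. q i)"
    by (simp only:) (rule sum.union_disjoint, auto)
  then show ?thesis using assms by simp
qed

lemma ex1_median_index:
  fixes q :: "nat \<Rightarrow> real"
  assumes nonneg: "\<And>i. i \<le> k \<Longrightarrow> q i \<ge> 0" and total: "(\<Sum>i\<le>k. q i) = 1"
  shows "\<exists>!j. j \<le> k \<and> (\<Sum>i<j. q i) < 1/2 \<and> (\<Sum>i\<le>j. q i) \<ge> 1/2"
proof (rule ex_ex1I)
  define j where "j = (LEAST j. (\<Sum>i\<le>j. q i) \<ge> 1/2)"
  have j: "(\<Sum>i\<le>j. q i) \<ge> 1/2" unfolding j_def by (rule LeastI[of _ k]) (use total in simp)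
  have "j \<le> k" unfolding j_def by (rule Least_le) (use total in simp)
  moreover have "(\<Sum>i<j. q i) < 1/2"
  proof (cases j)
    case (Suc m)
    then have "\<not> (\<Sum>i\<le>m. q i) \<ge> 1/2" using not_less_Least[of m "\<lambda>j. (\<Sum>i\<le>j. q i) \<ge> 1/2"] unfolding j_def by simp
    then show ?thesis using Suc by (simp add: lessThan_Suc_atMost)
  qed simp
  ultimately show "\<exists>j. j \<le> k \<and> (\<Sum>i<j. q i) < 1/2 \<and> (\<Sum>i\<le>j. q i) \<ge> 1/2" using j by blast
next
  have "\<not> a < b" if "a \<le> k" "b \<le> k" "(\<Sum>i\<le>a. q i) \<ge> 1/2" "(\<Sum>i<b. q i) < 1/2" for a b
  proof
    assume "a < b"
    then have "(\<Sum>i\<le>a. q i) \<le> (\<Sum>i<b. q i)"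
      by (intro sum_mono2) (use that nonneg in auto)
    then show False using that by simp
  qed
  then show "a = b" if "a \<le> k \<and> (\<Sum>i<a. q i) < 1/2 \<and> (\<Sum>i\<le>a. q i) \<ge> 1/2"
    "b \<le> k \<and> (\<Sum>i<b. q i) < 1/2 \<and> (\<Sum>i\<le>b. q i) \<ge> 1/2" for a b
    using that by (meson linorder_neqE_nat)
qed

section \<open>Measures invariant under reflections\<close>

lemma distr_lborel_reflect:
  "distr lborel lborel (\<lambda>x. c - x) = (lborel :: real measure)"
  using lborel_real_affine[of "-1" c] by (simp add: density_1 cong: distr_cong)

lemma distr_PiM_lborel_reflect:
  fixes c :: "'i \<Rightarrow> real"
  assumes I: "finite I"
  shows "distr (PiM I (\<lambda>_. lborel)) (PiM I (\<lambda>_. lborel)) (\<lambda>f. \<lambda>i\<in>I. c i - f i) = PiM I (\<lambda>_. lborel)"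
    (is "distr ?M ?M ?T = ?M")
proof -
  interpret product_sigma_finite "\<lambda>_::'i. lborel :: real measure" by standard
  have [measurable]: "?T \<in> measurable ?M ?M" by measurable
  show ?thesis
  proof (rule PiM_eqI)
    fix A :: "'i \<Rightarrow> real set" assume A: "\<And>i. i \<in> I \<Longrightarrow> A i \<in> sets lborel"
    let ?B = "\<lambda>i. (\<lambda>x. c i - x) -` A i"
    have meas_B: "?B i \<in> sets lborel" if "i \<in> I" for i
      using measurable_sets[of "\<lambda>x. c i - x" borel borel "A i"] A[OF that] by simp
    have B: "emeasure lborel (?B i) = emeasure lborel (A i)" if "i \<in> I" for i
    proof -
      have "emeasure (distr lborel lborel (\<lambda>x. c i - x)) (A i) = emeasure lborel (?B i)"
        using A[OF that] by (subst emeasure_distr) auto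
      then show ?thesis by (simp add: distr_lborel_reflect)
    qed
    have "?T -` Pi\<^sub>E I A \<inter> space ?M = Pi\<^sub>E I ?B"
      by (auto simp: space_PiM PiE_iff)
    then have "emeasure (distr ?M ?M ?T) (Pi\<^sub>E I A) = emeasure ?M (Pi\<^sub>E I ?B)"
      using A I by (subst emeasure_distr) (auto intro!: sets_PiM_I_finite)
    also have "\<dots> = (\<Prod>i\<in>I. emeasure lborel (A i))"
      using I meas_B B by (subst emeasure_PiM) auto
    finally show "emeasure (distr ?M ?M ?T) (Pi\<^sub>E I A) = (\<Prod>i\<in>I. emeasure lborel (A i))" .
  qed (use I in auto)
qed

text \<open>A map that moves only the first coordinate, by a transformation depending on the second, preserves
the product measure if each of these transformations preserves the first factor: by Fubini, the
measure of the preimage of a set is computed section by section.\<close>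

lemma distr_pair_fibrewise:
  assumes sf: "sigma_finite_measure A" "sigma_finite_measure B"
    and T[measurable]: "(\<lambda>(a, b). T a b) \<in> measurable (A \<Otimes>\<^sub>M B) A"
    and inv: "\<And>b. b \<in> space B \<Longrightarrow> distr A A (\<lambda>a. T a b) = A"
  shows "distr (A \<Otimes>\<^sub>M B) (A \<Otimes>\<^sub>M B) (\<lambda>(a, b). (T a b, b)) = A \<Otimes>\<^sub>M B"
    (is "distr ?M ?M ?T = ?M")
proof (rule measure_eqI)
  interpret pair_sigma_finite A B using sf by (simp add: pair_sigma_finite_def)
  fix S assume "S \<in> sets (distr ?M ?M ?T)"
  then have S[measurable]: "S \<in> sets ?M" by simp
  have [measurable]: "?T \<in> measurable ?M ?M" by measurable
  have pre: "?T -` S \<inter> space ?M \<in> sets ?M" by measurable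
  have "emeasure (distr ?M ?M ?T) S = emeasure ?M (?T -` S \<inter> space ?M)"
    by (rule emeasure_distr) auto
  also have "\<dots> = (\<integral>\<^sup>+b. emeasure A ((\<lambda>a. (a, b)) -` (?T -` S \<inter> space ?M)) \<partial>B)"
    by (rule emeasure_pair_measure_alt2[OF pre])
  also have "\<dots> = (\<integral>\<^sup>+b. emeasure A ((\<lambda>a. (a, b)) -` S) \<partial>B)"
  proof (rule nn_integral_cong)
    fix b assume b: "b \<in> space B"
    let ?S = "(\<lambda>a. (a, b)) -` S"
    have Tb: "(\<lambda>a. T a b) \<in> measurable A A"
      using measurable_comp[OF measurable_Pair2'[OF b] T] by (simp only: comp_def case_prod_conv)
    have Sb: "?S \<in> sets A" using sets_Pair2[OF S] .
    have "emeasure A ?S = emeasure (distr A A (\<lambda>a. T a b)) ?S" by (simp add: inv[OF b])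
    also have "\<dots> = emeasure A ((\<lambda>a. T a b) -` ?S \<inter> space A)" by (rule emeasure_distr[OF Tb Sb])
    also have "(\<lambda>a. T a b) -` ?S \<inter> space A = (\<lambda>a. (a, b)) -` (?T -` S \<inter> space ?M)"
      using b by (auto simp: space_pair_measure)
    finally show "emeasure A ((\<lambda>a. (a, b)) -` (?T -` S \<inter> space ?M)) = emeasure A ?S" by simp
  qed
  also have "\<dots> = emeasure ?M S" by (rule emeasure_pair_measure_alt2[OF S, symmetric])
  finally show "emeasure (distr ?M ?M ?T) S = emeasure ?M S" .
qed simp

lemma distr_density_invariant:
  assumes f[measurable]: "f \<in> borel_measurable M" and T[measurable]: "T \<in> measurable M M"
    and inv: "distr M M T = M" and fT: "AE x in M. f (T x) = f x"
  shows "distr (density M f) (density M f) T = density M f"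
proof -
  have "density M f = density (distr M M T) f" by (simp add: inv)
  also have "\<dots> = distr (density M (\<lambda>x. f (T x))) M T" by (rule density_distr) measurable
  also have "density M (\<lambda>x. f (T x)) = density M f" using fT by (intro density_cong) auto
  finally have "density M f = distr (density M f) M T" .
  also have "\<dots> = distr (density M f) (density M f) T" by (rule distr_cong) simp_all
  finally show ?thesis by (rule sym)
qed

section \<open>The posterior under a flat prior for the common coefficients\<close>

text \<open>The coefficients enter only through the residual sum of squares, so changes of the coefficients
that keep the length of the residual leave the likelihood unchanged.\<close>

lemma likelihood_eq_exp:
  assumes X1: "X1 \<in> carrier_mat n k1" and Z: "Z \<in> carrier_mat n kl" and y: "y \<in> carrier_vec n"
    and v: "v \<in> carrier_vec k1" and w: "w \<in> carrier_vec kl"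
  shows "likelihood X1 Z y v w s =
    (1 / sqrt (2 * pi * s\<^sup>2)) ^ n *
    exp (- ((y - (X1 *\<^sub>v v + Z *\<^sub>v w)) \<bullet> (y - (X1 *\<^sub>v v + Z *\<^sub>v w))) / (2 * s\<^sup>2))"
proof -
  let ?\<mu> = "X1 *\<^sub>v v + Z *\<^sub>v w"
  have \<mu>: "?\<mu> \<in> carrier_vec n" using X1 Z v w by auto
  have "(y - ?\<mu>) \<bullet> (y - ?\<mu>) = (\<Sum>i<n. (y $ i - ?\<mu> $ i)\<^sup>2)"
    using y carrier_vecD[OF \<mu>]
    by (simp add: scalar_prod_def power2_eq_square lessThan_atLeast0 del: index_add_vec index_mult_mat_vec)
  then have "- ((y - ?\<mu>) \<bullet> (y - ?\<mu>)) / (2 * s\<^sup>2) = (\<Sum>i<n. - (y $ i - ?\<mu> $ i)\<^sup>2 / (2 * s\<^sup>2))"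
    by (simp add: sum_negf sum_divide_distrib)
  moreover have "likelihood X1 Z y v w s =
      (\<Prod>i<n. 1 / sqrt (2 * pi * s\<^sup>2) * exp (- (y $ i - ?\<mu> $ i)\<^sup>2 / (2 * s\<^sup>2)))"
    unfolding likelihood_def normal_density_def using y by simp
  ultimately show ?thesis
    by (simp only: prod.distrib prod_constant card_lessThan exp_sum[OF finite_lessThan])
qed

text \<open>If \<open>m\<close> is the least squares fit to \<open>y - Z w\<close>, its residual \<open>e\<close> is orthogonal to the columns of
\<open>X1\<close>. The residuals at \<open>v\<close> and at the reflected point \<open>2 m - v\<close> are \<open>e - X1 (v - m)\<close> and
\<open>e + X1 (v - m)\<close>, which have the same length by Pythagoras.\<close>

lemma likelihood_reflect:
  assumes X1: "X1 \<in> carrier_mat n k1" and Z: "Z \<in> carrier_mat n kl" and y: "y \<in> carrier_vec n"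
    and v: "v \<in> carrier_vec k1" and w: "w \<in> carrier_vec kl" and m: "m \<in> carrier_vec k1"
    and normal_eq: "X1\<^sup>T *\<^sub>v (X1 *\<^sub>v m) = X1\<^sup>T *\<^sub>v (y - Z *\<^sub>v w)"
  shows "likelihood X1 Z y (2 \<cdot>\<^sub>v m - v) w s = likelihood X1 Z y v w s"
proof -
  define e where "e = y - Z *\<^sub>v w - X1 *\<^sub>v m"
  define d where "d = X1 *\<^sub>v (v - m)"
  have c[simp]: "Z *\<^sub>v w \<in> carrier_vec n" "X1 *\<^sub>v m \<in> carrier_vec n" "X1 *\<^sub>v v \<in> carrier_vec n"
    using X1 Z v w m by auto
  have e: "e \<in> carrier_vec n" and d: "d \<in> carrier_vec n"
    unfolding e_def d_def using y X1 v m by auto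
  have X1e: "X1\<^sup>T *\<^sub>v e = 0\<^sub>v k1"
    unfolding e_def using X1 y normal_eq
    by (subst mult_minus_distrib_mat_vec[of _ k1 n]) auto
  have "e \<bullet> d = (X1\<^sup>T *\<^sub>v e) \<bullet> (v - m)"
    unfolding d_def using X1 e v m by (intro transpose_vec_mult_scalar[symmetric]) auto
  then have ed: "e \<bullet> d = 0" using X1e v m by simp
  have dd: "d = X1 *\<^sub>v v - X1 *\<^sub>v m"
    unfolding d_def by (rule mult_minus_distrib_mat_vec[OF X1 v m])
  have 1: "y - (X1 *\<^sub>v v + Z *\<^sub>v w) = e - d"
    unfolding e_def dd using y X1 Z v w m by (intro eq_vecI) auto
  have Xr: "X1 *\<^sub>v (2 \<cdot>\<^sub>v m - v) = 2 \<cdot>\<^sub>v (X1 *\<^sub>v m) - X1 *\<^sub>v v"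
    using X1 v m by (subst mult_minus_distrib_mat_vec[of _ n k1]) (auto simp: mult_mat_vec)
  have 2: "y - (X1 *\<^sub>v (2 \<cdot>\<^sub>v m - v) + Z *\<^sub>v w) = e - (- d)"
    unfolding e_def dd Xr using y X1 Z v w m by (intro eq_vecI) auto
  (* The cross terms vanish. *)
  have "(e - d) \<bullet> (e - d) = (e - (- d)) \<bullet> (e - (- d))"
    using e d ed scalar_prod_diff_diff[of e n d] scalar_prod_diff_diff[of e n "- d"] by simp
  moreover have "2 \<cdot>\<^sub>v m - v \<in> carrier_vec k1" using m v by simp
  ultimately show ?thesis
    by (simp only: likelihood_eq_exp[OF X1 Z y _ w] v 1 2)
qed

lemma borel_measurable_likelihood:
  assumes X1: "X1 \<in> carrier_mat n k1" and Z: "Z \<in> carrier_mat n kl" and y: "y \<in> carrier_vec n"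
    and \<nu>: "sets \<nu> = sets borel"
  shows "(\<lambda>(b1, bl, s). likelihood X1 Z y (vec k1 b1) (vec kl bl) s) \<in> borel_measurable (param_measure k1 kl \<nu>)"
proof -
  note [measurable_cong] = \<nu>
  have eq: "likelihood X1 Z y (vec k1 b1) (vec kl bl) s =
    (\<Prod>i<n. 1 / sqrt (2 * pi * s\<^sup>2) * exp (- (y $ i -
      ((\<Sum>j<k1. X1 $$ (i, j) * b1 j) + (\<Sum>j<kl. Z $$ (i, j) * bl j)))\<^sup>2 / (2 * s\<^sup>2)))" for b1 bl s
    unfolding likelihood_def normal_density_def using X1 Z y
    by (intro prod.cong) (auto simp: mult_mat_vec_index_sum[OF X1] mult_mat_vec_index_sum[OF Z] simp del: index_mult_mat_vec)
  show ?thesis unfolding eq param_measure_def by measurable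
qed

lemma borel_measurable_prior_times_likelihood:
  assumes X1: "X1 \<in> carrier_mat n k1" and Z: "Z \<in> carrier_mat n kl" and y: "y \<in> carrier_vec n"
    and prior: "valid_prior k1 kl \<pi> \<nu>"
  shows "prior_times_likelihood X1 Z y \<pi> \<in> borel_measurable (param_measure k1 kl \<nu>)"
proof -
  have \<nu>: "sets \<nu> = sets borel"
    and [measurable]: "(\<lambda>(b1, bl, s). \<pi> (vec k1 b1) (vec kl bl) s) \<in> borel_measurable (param_measure k1 kl \<nu>)"
    using prior by (auto simp: valid_prior_def)
  note [measurable] = borel_measurable_likelihood[OF X1 Z y \<nu>]
  have "(\<lambda>\<theta>. ennreal ((case \<theta> of (b1, bl, s) \<Rightarrow> \<pi> (vec k1 b1) (vec kl bl) s) *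
      (case \<theta> of (b1, bl, s) \<Rightarrow> likelihood X1 Z y (vec k1 b1) (vec kl bl) s)))
      \<in> borel_measurable (param_measure k1 kl \<nu>)"
    by measurable
  then show ?thesis
    unfolding prior_times_likelihood_def using X1 Z by (simp add: case_prod_beta Let_def)
qed

text \<open>The reflection of the common coefficients about \<open>M (y - Z \<beta>)\<close>, where \<open>\<beta>\<close> are the noncommon
coefficients. For \<open>M\<close> the least squares matrix of \<open>X1\<close>, this centre maximises the likelihood in
the common coefficients. The restriction makes the result an element of the product space.\<close>

definition reflect_common ::
    "real mat \<Rightarrow> real mat \<Rightarrow> real vec \<Rightarrow> real mat \<Rightarrow> param \<Rightarrow> param" where
  "reflect_common X1 Z y M = (\<lambda>(b1, bl, s).
     (\<lambda>i\<in>{..<dim_col X1}. 2 * (M *\<^sub>v (y - Z *\<^sub>v vec (dim_col Z) bl)) $ i - b1 i, bl, s))"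

text \<open>Written out in coordinates, the centre of the reflection is visibly measurable in the noncommon
coefficients and commutes with expectations.\<close>

lemma ols_residual_coefficient_affine:
  fixes M :: "real mat"
  assumes Z: "Z \<in> carrier_mat n kl" and M: "M \<in> carrier_mat k1 n" and y: "y \<in> carrier_vec n"
    and i: "i < k1"
  shows "(M *\<^sub>v (y - Z *\<^sub>v vec kl bl)) $ i =
    (M *\<^sub>v y) $ i - (\<Sum>j<kl. (M * Z) $$ (i, j) * bl j)"
proof -
  have "M *\<^sub>v (y - Z *\<^sub>v vec kl bl) = M *\<^sub>v y - (M * Z) *\<^sub>v vec kl bl"
    using M Z y by (subst mult_minus_distrib_mat_vec[OF M]) auto
  then show ?thesis
    using M Z y i mult_mat_vec_index_sum[of "M * Z" k1 kl "vec kl bl" i] by simp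
qed

lemma sigma_finite_PiM_lborel:
  "sigma_finite_measure (\<Pi>\<^sub>M i\<in>{..<k :: nat}. (lborel :: real measure))"
proof -
  interpret product_sigma_finite "\<lambda>_::nat. lborel :: real measure" by standard
  show ?thesis by (rule sigma_finite) simp
qed

text \<open>Priors are constrained only for positive standard deviations, so the symmetry of the posterior
density holds only almost everywhere.\<close>

lemma AE_param_measure_sd_pos:
  assumes \<nu>: "sets \<nu> = sets borel" "sigma_finite_measure \<nu>" "emeasure \<nu> {..0} = 0"
  shows "AE (b1, bl, s) in param_measure k1 kl \<nu>. s > 0"
proof -
  note [measurable_cong] = \<nu>(1)
  let ?A = "\<lambda>k. \<Pi>\<^sub>M i\<in>{..<k :: nat}. (lborel :: real measure)"
  interpret B: pair_sigma_finite "?A kl" \<nu>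
    using sigma_finite_PiM_lborel \<nu>(2) by (simp add: pair_sigma_finite_def)
  interpret AB: pair_sigma_finite "?A k1" "?A kl \<Otimes>\<^sub>M \<nu>"
    using sigma_finite_PiM_lborel B.sigma_finite_measure_axioms by (simp add: pair_sigma_finite_def)
  have "{..0} \<in> null_sets \<nu>" using \<nu> by (auto simp: null_sets_def)
  then have s: "AE s in \<nu>. s > 0" by (rule AE_I') auto
  have "AE q in ?A kl \<Otimes>\<^sub>M \<nu>. snd q > 0"
    by (rule B.AE_pair_measure) (use s in \<open>auto, measurable\<close>)
  then have "AE \<theta> in ?A k1 \<Otimes>\<^sub>M ?A kl \<Otimes>\<^sub>M \<nu>. snd (snd \<theta>) > 0"
    by (intro AB.AE_pair_measure) (auto, measurable)
  then show ?thesis unfolding param_measure_def case_prod_beta .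
qed

lemma distr_param_reflect_common:
  assumes X1: "X1 \<in> carrier_mat n k1" and Z: "Z \<in> carrier_mat n kl" and y: "y \<in> carrier_vec n"
    and M: "M \<in> carrier_mat k1 n"
    and \<nu>: "sets \<nu> = sets borel" "sigma_finite_measure \<nu>"
  shows "reflect_common X1 Z y M \<in> measurable (param_measure k1 kl \<nu>) (param_measure k1 kl \<nu>)"
    and "distr (param_measure k1 kl \<nu>) (param_measure k1 kl \<nu>) (reflect_common X1 Z y M) = param_measure k1 kl \<nu>"
proof -
  note [measurable_cong] = \<nu>(1)
  let ?A = "\<Pi>\<^sub>M i\<in>{..<k1}. (lborel :: real measure)" and ?B = "(\<Pi>\<^sub>M i\<in>{..<kl}. (lborel :: real measure)) \<Otimes>\<^sub>M \<nu>"
  define T where "T = (\<lambda>(b1 :: nat \<Rightarrow> real) (bl :: nat \<Rightarrow> real, s :: real).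
      \<lambda>i\<in>{..<k1}. 2 * ((M *\<^sub>v y) $ i - (\<Sum>j<kl. (M * Z) $$ (i, j) * bl j)) - b1 i)"
  have T: "reflect_common X1 Z y M = (\<lambda>(b1, q). (T b1 q, q))"
    unfolding reflect_common_def T_def using X1 Z ols_residual_coefficient_affine[OF Z M y]
    by (auto simp: fun_eq_iff restrict_def simp del: index_mult_mat_vec)
  have [measurable]: "(\<lambda>(b1, q). T b1 q) \<in> measurable (?A \<Otimes>\<^sub>M ?B) ?A"
    unfolding T_def case_prod_beta by measurable
  show "reflect_common X1 Z y M \<in> measurable (param_measure k1 kl \<nu>) (param_measure k1 kl \<nu>)"
    unfolding T param_measure_def by measurable
  interpret B: pair_sigma_finite "\<Pi>\<^sub>M i\<in>{..<kl}. (lborel :: real measure)" \<nu>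
    using sigma_finite_PiM_lborel \<nu>(2) by (simp add: pair_sigma_finite_def)
  have "distr (?A \<Otimes>\<^sub>M ?B) (?A \<Otimes>\<^sub>M ?B) (\<lambda>(b1, q). (T b1 q, q)) = ?A \<Otimes>\<^sub>M ?B"
  proof (rule distr_pair_fibrewise[OF sigma_finite_PiM_lborel B.sigma_finite_measure_axioms])
    show "distr ?A ?A (\<lambda>a. T a q) = ?A" for q
      unfolding T_def case_prod_beta by (rule distr_PiM_lborel_reflect) simp
  qed measurable
  then show "distr (param_measure k1 kl \<nu>) (param_measure k1 kl \<nu>) (reflect_common X1 Z y M) = param_measure k1 kl \<nu>"
    unfolding T param_measure_def .
qed

text \<open>The reflection preserves the base measure, the likelihood, and a prior that does not depend on the
common coefficients.\<close>

lemma posterior_reflect_common: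
  assumes X1: "X1 \<in> carrier_mat n k1" and Z: "Z \<in> carrier_mat n kl" and y: "y \<in> carrier_vec n"
    and M: "M \<in> carrier_mat k1 n"
    and normal_eq: "\<And>v. v \<in> carrier_vec n \<Longrightarrow> X1\<^sup>T *\<^sub>v (X1 *\<^sub>v (M *\<^sub>v v)) = X1\<^sup>T *\<^sub>v v"
    and prior: "valid_prior k1 kl \<pi> \<nu>"
    and flat: "\<forall>\<beta>1 \<in> carrier_vec k1. \<forall>\<beta>l \<in> carrier_vec kl. \<forall>s>0. \<pi> \<beta>1 \<beta>l s = \<pi>' \<beta>l s"
  shows "distr (posterior X1 Z y \<pi> \<nu>) (posterior X1 Z y \<pi> \<nu>) (reflect_common X1 Z y M) = posterior X1 Z y \<pi> \<nu>"
proof -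
  have \<nu>: "sets \<nu> = sets borel" "sigma_finite_measure \<nu>" "emeasure \<nu> {..0} = 0"
    using prior by (auto simp: valid_prior_def)
  note [measurable_cong] = \<nu>(1)
  let ?PM = "param_measure k1 kl \<nu>" and ?T = "reflect_common X1 Z y M"
  have dims: "dim_col X1 = k1" "dim_col Z = kl" using X1 Z by auto
  note [measurable] = borel_measurable_prior_times_likelihood[OF X1 Z y prior]
  have pos: "AE \<theta> in ?PM. snd (snd \<theta>) > 0"
    using AE_param_measure_sd_pos[OF \<nu>, of k1 kl] by (simp add: case_prod_beta)
  have inv: "prior_times_likelihood X1 Z y \<pi> (?T \<theta>) = prior_times_likelihood X1 Z y \<pi> \<theta>"
    if "snd (snd \<theta>) > 0" for \<theta>
  proof -
    obtain b1 bl s where \<theta>: "\<theta> = (b1, bl, s)" by (cases \<theta>)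
    define m where "m = M *\<^sub>v (y - Z *\<^sub>v vec kl bl)"
    have m: "m \<in> carrier_vec k1" unfolding m_def using M Z y by auto
    let ?b = "\<lambda>i\<in>{..<k1}. 2 * m $ i - b1 i"
    have T: "?T (b1, bl, s) = (?b, bl, s)" by (simp add: reflect_common_def dims m_def)
    have b: "vec k1 ?b = 2 \<cdot>\<^sub>v m - vec k1 b1"
      using m by (intro eq_vecI) auto
    have "likelihood X1 Z y (2 \<cdot>\<^sub>v m - vec k1 b1) (vec kl bl) s = likelihood X1 Z y (vec k1 b1) (vec kl bl) s"
      by (rule likelihood_reflect[OF X1 Z y _ _ m]) (use normal_eq Z y in \<open>auto simp: m_def\<close>)
    moreover have "\<pi> (2 \<cdot>\<^sub>v m - vec k1 b1) (vec kl bl) s = \<pi> (vec k1 b1) (vec kl bl) s"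
      using flat m that \<theta> by simp
    ultimately show ?thesis
      unfolding prior_times_likelihood_def \<theta> T by (simp add: dims b Let_def)
  qed
  show ?thesis
    unfolding posterior_def dims
  proof (rule distr_density_invariant[OF _ distr_param_reflect_common[OF X1 Z y M \<nu>(1,2)]])
    show "AE \<theta> in ?PM. prior_times_likelihood X1 Z y \<pi> (?T \<theta>) / marginal_likelihood X1 Z y \<pi> \<nu> =
      prior_times_likelihood X1 Z y \<pi> \<theta> / marginal_likelihood X1 Z y \<pi> \<nu>"
      using pos by eventually_elim (simp add: inv)
  qed measurable
qed

lemma prob_space_posterior:
  assumes X1: "X1 \<in> carrier_mat n k1" and Z: "Z \<in> carrier_mat n kl" and y: "y \<in> carrier_vec n"
    and prior: "valid_prior k1 kl \<pi> \<nu>" and proper: "proper_posterior_with_means X1 Z y \<pi> \<nu>"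
  shows "prob_space (posterior X1 Z y \<pi> \<nu>)"
proof
  have dims: "dim_col X1 = k1" "dim_col Z = kl" using X1 Z by auto
  note [measurable] = borel_measurable_prior_times_likelihood[OF X1 Z y prior]
  let ?m = "marginal_likelihood X1 Z y \<pi> \<nu>"
  have m: "0 < ?m" "?m < \<infinity>" using proper by (auto simp: proper_posterior_with_means_def)
  have "emeasure (posterior X1 Z y \<pi> \<nu>) (space (posterior X1 Z y \<pi> \<nu>)) =
      (\<integral>\<^sup>+\<theta>. prior_times_likelihood X1 Z y \<pi> \<theta> / ?m \<partial>param_measure k1 kl \<nu>)"
    unfolding posterior_def dims space_density
    by (subst emeasure_density) (auto intro!: nn_integral_cong)
  also have "\<dots> = ?m / ?m"
    by (subst nn_integral_divide) (auto simp: marginal_likelihood_def dims)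
  also have "\<dots> = 1" using m by (intro ennreal_divide_self) auto
  finally show "emeasure (posterior X1 Z y \<pi> \<nu>) (space (posterior X1 Z y \<pi> \<nu>)) = 1" .
qed

text \<open>By symmetry the posterior mean of \<open>b1 i\<close> equals that of \<open>2 c i - b1 i\<close>, where the centre \<open>c\<close>
is an affine function of the noncommon coefficients; hence it is the posterior mean of \<open>c i\<close>, which
is the centre evaluated at the mean noncommon coefficients.\<close>

lemma posterior_mean_common_flat_prior:
  assumes X1: "X1 \<in> carrier_mat n k1" and Z: "Z \<in> carrier_mat n kl" and y: "y \<in> carrier_vec n"
    and M: "M \<in> carrier_mat k1 n"
    and normal_eq: "\<And>v. v \<in> carrier_vec n \<Longrightarrow> X1\<^sup>T *\<^sub>v (X1 *\<^sub>v (M *\<^sub>v v)) = X1\<^sup>T *\<^sub>v v"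
    and prior: "valid_prior k1 kl \<pi> \<nu>" and proper: "proper_posterior_with_means X1 Z y \<pi> \<nu>"
    and flat: "\<forall>\<beta>1 \<in> carrier_vec k1. \<forall>\<beta>l \<in> carrier_vec kl. \<forall>s>0. \<pi> \<beta>1 \<beta>l s = \<pi>' \<beta>l s"
  shows "posterior_mean_common X1 Z y \<pi> \<nu> = M *\<^sub>v (y - Z *\<^sub>v posterior_mean_noncommon X1 Z y \<pi> \<nu>)"
proof (rule eq_vecI)
  let ?P = "posterior X1 Z y \<pi> \<nu>" and ?T = "reflect_common X1 Z y M"
  let ?bn = "posterior_mean_noncommon X1 Z y \<pi> \<nu>"
  have dims: "dim_col X1 = k1" "dim_col Z = kl" using X1 Z by auto
  interpret prob_space ?P by (rule prob_space_posterior[OF X1 Z y prior proper])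
  have \<nu>: "sets \<nu> = sets borel" "sigma_finite_measure \<nu>"
    using prior by (auto simp: valid_prior_def)
  have bn: "?bn = vec kl (\<lambda>j. \<integral>(b1, bl, s). bl j \<partial>?P)" by (simp add: posterior_mean_noncommon_def dims)
  have T_meas: "?T \<in> measurable ?P ?P"
    using distr_param_reflect_common(1)[OF X1 Z y M \<nu>] by (simp add: posterior_def dims)
  have int1: "integrable ?P (\<lambda>(b1, bl, s). b1 i)" if "i < k1" for i
    using proper that by (simp add: proper_posterior_with_means_def dims)
  have intl: "integrable ?P (\<lambda>(b1, bl, s). bl j)" if "j < kl" for j
    using proper that by (simp add: proper_posterior_with_means_def dims)
  fix i assume "i < dim_vec (M *\<^sub>v (y - Z *\<^sub>v ?bn))"
  then have i: "i < k1" using M by simp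
  let ?c = "\<lambda>j. (M * Z) $$ (i, j)"
  let ?mean = "\<lambda>\<theta>. (M *\<^sub>v y) $ i - (\<Sum>j<kl. ?c j * (case \<theta> of (b1, bl, s) \<Rightarrow> bl j))"
  have int_mean: "integrable ?P ?mean"
    by (intro Bochner_Integration.integrable_diff Bochner_Integration.integrable_sum
        integrable_mult_right intl) auto
  have "(\<integral>(b1, bl, s). b1 i \<partial>?P) = (\<integral>(b1, bl, s). b1 i \<partial>distr ?P ?P ?T)"
    by (simp add: posterior_reflect_common[OF X1 Z y M normal_eq prior flat])
  also have "\<dots> = (\<integral>\<theta>. (case ?T \<theta> of (b1, bl, s) \<Rightarrow> b1 i) \<partial>?P)"
    by (rule integral_distr[OF T_meas]) (use int1[OF i] in auto)
  also have "\<dots> = (\<integral>\<theta>. 2 * ?mean \<theta> - (case \<theta> of (b1, bl, s) \<Rightarrow> b1 i) \<partial>?P)"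
    using i dims ols_residual_coefficient_affine[OF Z M y i]
    by (intro Bochner_Integration.integral_cong) (auto simp: reflect_common_def simp del: index_mult_mat_vec)
  also have "\<dots> = 2 * (\<integral>\<theta>. ?mean \<theta> \<partial>?P) - (\<integral>(b1, bl, s). b1 i \<partial>?P)"
    using int_mean int1[OF i]
    by (subst Bochner_Integration.integral_diff, intro integrable_mult_right)
      (simp_all only: integral_mult_right_zero)
  finally have "(\<integral>(b1, bl, s). b1 i \<partial>?P) = (\<integral>\<theta>. ?mean \<theta> \<partial>?P)" by simp
  also have "\<dots> = (M *\<^sub>v y) $ i - (\<integral>\<theta>. (\<Sum>j<kl. ?c j * (case \<theta> of (b1, bl, s) \<Rightarrow> bl j)) \<partial>?P)"
    by (subst Bochner_Integration.integral_diff)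
      (auto intro!: Bochner_Integration.integrable_sum integrable_mult_right intl simp: prob_space simp del: index_mult_mat_vec)
  also have "(\<integral>\<theta>. (\<Sum>j<kl. ?c j * (case \<theta> of (b1, bl, s) \<Rightarrow> bl j)) \<partial>?P) =
      (\<Sum>j<kl. ?c j * (\<integral>(b1, bl, s). bl j \<partial>?P))"
    by (subst Bochner_Integration.integral_sum) (auto intro!: integrable_mult_right intl)
  also have "(M *\<^sub>v y) $ i - \<dots> = (M *\<^sub>v (y - Z *\<^sub>v ?bn)) $ i"
    unfolding bn by (rule ols_residual_coefficient_affine[OF Z M y i, symmetric])
  finally show "posterior_mean_common X1 Z y \<pi> \<nu> $ i = (M *\<^sub>v (y - Z *\<^sub>v ?bn)) $ i"
    unfolding posterior_mean_common_def dims index_vec[OF i] .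
qed (use M X1 in \<open>simp add: posterior_mean_common_def\<close>)

section \<open>Least squares and fitted vectors\<close>

text \<open>The matrix that maps an observation to its least squares coefficients.\<close>

definition ols_mat :: "real mat \<Rightarrow> real mat" where
  "ols_mat A = inv_mat (A\<^sup>T * A) * A\<^sup>T"

lemma ols_mat_normal_equations:
  assumes A: "A \<in> carrier_mat n k"
    and inj: "full_column_rank A"
  shows "ols_mat A \<in> carrier_mat k n"
    and "v \<in> carrier_vec n \<Longrightarrow> A\<^sup>T *\<^sub>v (A *\<^sub>v (ols_mat A *\<^sub>v v)) = A\<^sup>T *\<^sub>v v"
proof -
  have G: "A\<^sup>T * A \<in> carrier_mat k k" using A by auto
  note I = inv_mat_full_rank[OF G full_column_rank_gram[OF A inj]]
  show M: "ols_mat A \<in> carrier_mat k n" unfolding ols_mat_def using I(1) A by auto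
  assume v: "v \<in> carrier_vec n"
  have Av: "A\<^sup>T *\<^sub>v v \<in> carrier_vec k" using A v by auto
  have "A\<^sup>T *\<^sub>v (A *\<^sub>v (ols_mat A *\<^sub>v v)) = (A\<^sup>T * A) *\<^sub>v (inv_mat (A\<^sup>T * A) *\<^sub>v (A\<^sup>T *\<^sub>v v))"
    unfolding ols_mat_def using A I(1) v
    by (subst assoc_mult_mat_vec[of "inv_mat (A\<^sup>T * A)" k k "A\<^sup>T" n]) auto
  also have "\<dots> = (A\<^sup>T * A * inv_mat (A\<^sup>T * A)) *\<^sub>v (A\<^sup>T *\<^sub>v v)"
    by (rule assoc_mult_mat_vec[OF G I(1) Av, symmetric])
  also have "\<dots> = A\<^sup>T *\<^sub>v v" using I(2) Av by simp
  finally show "A\<^sup>T *\<^sub>v (A *\<^sub>v (ols_mat A *\<^sub>v v)) = A\<^sup>T *\<^sub>v v" .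
qed

text \<open>The matrix \<open>Q\<^sub>1\<close> maps a vector to its least squares residual, which is orthogonal to the columns of
\<open>A\<close>; the last claim follows because \<open>u\<close> and \<open>Q\<^sub>1 u\<close> differ by a combination of these columns.\<close>

lemma Q1_mat_residual:
  assumes A: "A \<in> carrier_mat n k"
    and inj: "full_column_rank A"
  shows "Q1_mat A \<in> carrier_mat n n"
    and "v \<in> carrier_vec n \<Longrightarrow> Q1_mat A *\<^sub>v v = v - A *\<^sub>v (ols_mat A *\<^sub>v v)"
    and "v \<in> carrier_vec n \<Longrightarrow> a \<in> carrier_vec k \<Longrightarrow> (A *\<^sub>v a) \<bullet> (Q1_mat A *\<^sub>v v) = 0"
    and "u \<in> carrier_vec n \<Longrightarrow> v \<in> carrier_vec n \<Longrightarrow>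
      (Q1_mat A *\<^sub>v u) \<bullet> (Q1_mat A *\<^sub>v v) = u \<bullet> (Q1_mat A *\<^sub>v v)"
proof -
  note M = ols_mat_normal_equations[OF A inj]
  have G: "A\<^sup>T * A \<in> carrier_mat k k" using A by auto
  note I = inv_mat_full_rank(1)[OF G full_column_rank_gram[OF A inj]]
  have Q: "Q1_mat A = 1\<^sub>m n - A * ols_mat A"
    unfolding Q1_mat_def ols_mat_def using A I by (simp add: assoc_mult_mat[OF A I])
  show Qc: "Q1_mat A \<in> carrier_mat n n" unfolding Q using A M(1) by auto
  have Qv: "Q1_mat A *\<^sub>v v = v - A *\<^sub>v (ols_mat A *\<^sub>v v)" if "v \<in> carrier_vec n" for v
    unfolding Q using A M(1) that
    by (subst minus_mult_distrib_mat_vec[of _ n n]) auto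
  then show "v \<in> carrier_vec n \<Longrightarrow> Q1_mat A *\<^sub>v v = v - A *\<^sub>v (ols_mat A *\<^sub>v v)" .
  have AQ: "(A *\<^sub>v a) \<bullet> (Q1_mat A *\<^sub>v v) = 0" if v: "v \<in> carrier_vec n" and a: "a \<in> carrier_vec k" for a v
  proof -
    have Qvc: "Q1_mat A *\<^sub>v v \<in> carrier_vec n" using Qc v by auto
    have "A\<^sup>T *\<^sub>v (Q1_mat A *\<^sub>v v) = A\<^sup>T *\<^sub>v v - A\<^sup>T *\<^sub>v (A *\<^sub>v (ols_mat A *\<^sub>v v))"
      unfolding Qv[OF v] by (rule mult_minus_distrib_mat_vec[of _ k n]) (use A M(1) v in auto)
    also have "\<dots> = 0\<^sub>v k" using M(2)[OF v] A v by auto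
    finally have 0: "A\<^sup>T *\<^sub>v (Q1_mat A *\<^sub>v v) = 0\<^sub>v k" .
    have "(A *\<^sub>v a) \<bullet> (Q1_mat A *\<^sub>v v) = (Q1_mat A *\<^sub>v v) \<bullet> (A *\<^sub>v a)"
      by (rule comm_scalar_prod[OF _ Qvc]) (use A a in auto)
    also have "\<dots> = (A\<^sup>T *\<^sub>v (Q1_mat A *\<^sub>v v)) \<bullet> a"
      by (rule transpose_vec_mult_scalar[OF A a Qvc, symmetric])
    finally show ?thesis using 0 a by simp
  qed
  then show "v \<in> carrier_vec n \<Longrightarrow> a \<in> carrier_vec k \<Longrightarrow> (A *\<^sub>v a) \<bullet> (Q1_mat A *\<^sub>v v) = 0" .
  assume u: "u \<in> carrier_vec n" and v: "v \<in> carrier_vec n"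
  have Mu: "ols_mat A *\<^sub>v u \<in> carrier_vec k" using M(1) u by auto
  have "(Q1_mat A *\<^sub>v u) \<bullet> (Q1_mat A *\<^sub>v v) = u \<bullet> (Q1_mat A *\<^sub>v v) - (A *\<^sub>v (ols_mat A *\<^sub>v u)) \<bullet> (Q1_mat A *\<^sub>v v)"
    unfolding Qv[OF u] by (rule minus_scalar_prod_distrib[of _ n]) (use A M(1) Qc u v in auto)
  then show "(Q1_mat A *\<^sub>v u) \<bullet> (Q1_mat A *\<^sub>v v) = u \<bullet> (Q1_mat A *\<^sub>v v)"
    using AQ[OF v Mu] by simp
qed

text \<open>The matrix \<open>Z\<^sup>T Q\<^sub>1 Z\<close> is the Gram matrix of the residuals of the columns of \<open>Z\<close>. It is invertible
because \<open>Q\<^sub>1 Z v = 0\<close> puts \<open>Z v\<close> into the column space of \<open>A\<close>.\<close>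

lemma shrunken_ols_normal_equations:
  assumes A: "A \<in> carrier_mat n k"
    and inj: "full_column_rank A"
    and Z: "Z \<in> carrier_mat n kl"
    and indep: "\<And>a c. a \<in> carrier_vec k \<Longrightarrow> c \<in> carrier_vec kl \<Longrightarrow> A *\<^sub>v a = Z *\<^sub>v c \<Longrightarrow> c = 0\<^sub>v kl"
    and y: "y \<in> carrier_vec n"
    and est: "\<beta> = b \<cdot>\<^sub>v (inv_mat (Z\<^sup>T * Q1_mat A * Z) *\<^sub>v (Z\<^sup>T *\<^sub>v (Q1_mat A *\<^sub>v y)))"
  shows "\<beta> \<in> carrier_vec kl"
    and "Z\<^sup>T *\<^sub>v (Q1_mat A *\<^sub>v (Z *\<^sub>v \<beta>)) = b \<cdot>\<^sub>v (Z\<^sup>T *\<^sub>v (Q1_mat A *\<^sub>v y))"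
proof -
  note R = Q1_mat_residual[OF A inj]
  let ?Q = "Q1_mat A"
  define S where "S = Z\<^sup>T * ?Q * Z"
  have S: "S \<in> carrier_mat kl kl" unfolding S_def using Z R(1) by auto
  have Sv: "S *\<^sub>v v = Z\<^sup>T *\<^sub>v (?Q *\<^sub>v (Z *\<^sub>v v))" if "v \<in> carrier_vec kl" for v
  proof -
    have ZT: "Z\<^sup>T \<in> carrier_mat kl n" and ZQ: "Z\<^sup>T * ?Q \<in> carrier_mat kl n"
      and Zv: "Z *\<^sub>v v \<in> carrier_vec n" using Z R(1) that by auto
    show ?thesis
      unfolding S_def assoc_mult_mat_vec[OF ZQ Z that] assoc_mult_mat_vec[OF ZT R(1) Zv] ..
  qed
  have injS: "full_column_rank S"
  proof (rule full_column_rankI[OF S])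
    fix v assume v: "v \<in> carrier_vec kl" and 0: "S *\<^sub>v v = 0\<^sub>v kl"
    have Zv: "Z *\<^sub>v v \<in> carrier_vec n" and QZv: "?Q *\<^sub>v (Z *\<^sub>v v) \<in> carrier_vec n"
      using Z R(1) v by auto
    have "(?Q *\<^sub>v (Z *\<^sub>v v)) \<bullet> (?Q *\<^sub>v (Z *\<^sub>v v)) = (Z *\<^sub>v v) \<bullet> (?Q *\<^sub>v (Z *\<^sub>v v))"
      by (rule R(4)[OF Zv Zv])
    also have "\<dots> = (?Q *\<^sub>v (Z *\<^sub>v v)) \<bullet> (Z *\<^sub>v v)" by (rule comm_scalar_prod[OF Zv QZv])
    also have "\<dots> = (Z\<^sup>T *\<^sub>v (?Q *\<^sub>v (Z *\<^sub>v v))) \<bullet> v"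
      by (rule transpose_vec_mult_scalar[OF Z v QZv, symmetric])
    also have "\<dots> = 0" using 0 Sv[OF v] v by simp
    finally have "?Q *\<^sub>v (Z *\<^sub>v v) = 0\<^sub>v n" by (rule scalar_prod_self_eq_0[OF QZv])
    then have z: "Z *\<^sub>v v - A *\<^sub>v (ols_mat A *\<^sub>v (Z *\<^sub>v v)) = 0\<^sub>v n" using R(2)[OF Zv] by simp
    have Mc: "ols_mat A *\<^sub>v (Z *\<^sub>v v) \<in> carrier_vec k"
      using ols_mat_normal_equations(1)[OF A inj] Zv by auto
    have Ac: "A *\<^sub>v (ols_mat A *\<^sub>v (Z *\<^sub>v v)) \<in> carrier_vec n" using A Mc by auto
    have "A *\<^sub>v (ols_mat A *\<^sub>v (Z *\<^sub>v v)) = Z *\<^sub>v v"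
      by (rule minus_vec_eq_0D[OF Zv Ac z])
    then show "v = 0\<^sub>v kl" using indep[OF Mc v] by simp
  qed
  note I = inv_mat_full_rank[OF S injS]
  define r where "r = Z\<^sup>T *\<^sub>v (?Q *\<^sub>v y)"
  have r: "r \<in> carrier_vec kl" unfolding r_def using Z R(1) y by auto
  have \<beta>: "\<beta> = b \<cdot>\<^sub>v (inv_mat S *\<^sub>v r)" unfolding est S_def r_def ..
  have Ir: "inv_mat S *\<^sub>v r \<in> carrier_vec kl" using I(1) r by auto
  then show \<beta>c: "\<beta> \<in> carrier_vec kl" by (simp add: \<beta>)
  have "S *\<^sub>v \<beta> = b \<cdot>\<^sub>v (S *\<^sub>v (inv_mat S *\<^sub>v r))" unfolding \<beta> by (rule mult_mat_vec[OF S Ir])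
  also have "S *\<^sub>v (inv_mat S *\<^sub>v r) = r"
    using assoc_mult_mat_vec[OF S I(1) r] I(2) r by simp
  finally show "Z\<^sup>T *\<^sub>v (?Q *\<^sub>v (Z *\<^sub>v \<beta>)) = b \<cdot>\<^sub>v (Z\<^sup>T *\<^sub>v (?Q *\<^sub>v y))"
    using Sv[OF \<beta>c] by (simp add: r_def)
qed

text \<open>Here \<open>fit w\<close> is the fitted vector of a model whose noncommon part contributes \<open>w\<close>. It splits
orthogonally into the projection of \<open>y\<close> onto the columns of \<open>A\<close> and \<open>Q\<^sub>1 w\<close>. The larger model has
the matrix \<open>Z\<close> and satisfies the normal equations; the smaller one contributes some \<open>Z a\<close>. Pairing
the normal equations with \<open>a\<close> eliminates the coefficients of the larger model, so that the inner
product depends on the smaller model only.\<close>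

lemma fitted_values_inner_nested:
  assumes A: "A \<in> carrier_mat n k"
    and inj: "full_column_rank A"
    and Z: "Z \<in> carrier_mat n kl" and \<beta>: "\<beta> \<in> carrier_vec kl" and a: "a \<in> carrier_vec kl"
    and y: "y \<in> carrier_vec n"
    and ne: "Z\<^sup>T *\<^sub>v (Q1_mat A *\<^sub>v (Z *\<^sub>v \<beta>)) = b \<cdot>\<^sub>v (Z\<^sup>T *\<^sub>v (Q1_mat A *\<^sub>v y))"
  defines "fit \<equiv> \<lambda>w. A *\<^sub>v (ols_mat A *\<^sub>v (y - w)) + w"
  shows "fit (Z *\<^sub>v a) \<bullet> fit (Z *\<^sub>v \<beta>) =
    (A *\<^sub>v (ols_mat A *\<^sub>v y)) \<bullet> (A *\<^sub>v (ols_mat A *\<^sub>v y)) + b * ((Z *\<^sub>v a) \<bullet> (Q1_mat A *\<^sub>v y))"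
proof -
  note R = Q1_mat_residual[OF A inj]
  note M = ols_mat_normal_equations(1)[OF A inj]
  let ?Q = "Q1_mat A"
  define m where "m = ols_mat A *\<^sub>v y"
  have m: "m \<in> carrier_vec k" unfolding m_def using M y by auto
  have Am: "A *\<^sub>v m \<in> carrier_vec n" using A m by auto
  have fit: "fit w = A *\<^sub>v m + ?Q *\<^sub>v w" if w: "w \<in> carrier_vec n" for w
  proof -
    have Mw: "ols_mat A *\<^sub>v w \<in> carrier_vec k" using M w by auto
    have "A *\<^sub>v (ols_mat A *\<^sub>v (y - w)) = A *\<^sub>v m - A *\<^sub>v (ols_mat A *\<^sub>v w)"
      unfolding mult_minus_distrib_mat_vec[OF M y w] mult_minus_distrib_mat_vec[OF A m[unfolded m_def] Mw] m_def ..
    then show ?thesis unfolding fit_def R(2)[OF w] using A M w m Mw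
      by (intro eq_vecI) auto
  qed
  have wa: "Z *\<^sub>v a \<in> carrier_vec n" and wb: "Z *\<^sub>v \<beta> \<in> carrier_vec n" using Z a \<beta> by auto
  have Qwa: "?Q *\<^sub>v (Z *\<^sub>v a) \<in> carrier_vec n" and Qwb: "?Q *\<^sub>v (Z *\<^sub>v \<beta>) \<in> carrier_vec n"
    and Qy: "?Q *\<^sub>v y \<in> carrier_vec n"
    using R(1) wa wb y by auto
  have "fit (Z *\<^sub>v a) \<bullet> fit (Z *\<^sub>v \<beta>) = (A *\<^sub>v m) \<bullet> (A *\<^sub>v m) + (A *\<^sub>v m) \<bullet> (?Q *\<^sub>v (Z *\<^sub>v \<beta>))
      + ((A *\<^sub>v m) \<bullet> (?Q *\<^sub>v (Z *\<^sub>v a)) + (?Q *\<^sub>v (Z *\<^sub>v a)) \<bullet> (?Q *\<^sub>v (Z *\<^sub>v \<beta>)))"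
    unfolding fit[OF wa] fit[OF wb] using Am Qwa Qwb
    by (simp add: add_scalar_prod_distrib[of _ n] scalar_prod_add_distrib[of _ n] comm_scalar_prod[of "?Q *\<^sub>v (Z *\<^sub>v a)" n "A *\<^sub>v m"])
  also have "\<dots> = (A *\<^sub>v m) \<bullet> (A *\<^sub>v m) + (Z *\<^sub>v a) \<bullet> (?Q *\<^sub>v (Z *\<^sub>v \<beta>))"
    using R(3)[OF wa m] R(3)[OF wb m] R(4)[OF wa wb] by simp
  also have "(Z *\<^sub>v a) \<bullet> (?Q *\<^sub>v (Z *\<^sub>v \<beta>)) = (Z\<^sup>T *\<^sub>v (?Q *\<^sub>v (Z *\<^sub>v \<beta>))) \<bullet> a"
    using transpose_vec_mult_scalar[OF Z a Qwb] comm_scalar_prod[OF wa Qwb] by simp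
  also have "\<dots> = b * ((Z\<^sup>T *\<^sub>v (?Q *\<^sub>v y)) \<bullet> a)"
    unfolding ne using Z Qy a by simp
  also have "\<dots> = b * ((Z *\<^sub>v a) \<bullet> (?Q *\<^sub>v y))"
    using transpose_vec_mult_scalar[OF Z a Qy] comm_scalar_prod[OF wa Qy] by simp
  finally show ?thesis unfolding m_def .
qed

section \<open>Second moments of linear predictions\<close>

lemma second_moment_bilinear:
  assumes x: "\<And>\<omega>. \<omega> \<in> space P \<Longrightarrow> x \<omega> \<in> carrier_vec k" and mom: "has_second_moments P k x"
    and v: "v \<in> carrier_vec k" and w: "w \<in> carrier_vec k"
  shows "integrable P (\<lambda>\<omega>. (x \<omega> \<bullet> v) * (x \<omega> \<bullet> w))"
    and "(\<integral>\<omega>. (x \<omega> \<bullet> v) * (x \<omega> \<bullet> w) \<partial>P) = v \<bullet> (second_moment_mat P k x *\<^sub>v w)"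
proof -
  have e: "(x \<omega> \<bullet> v) * (x \<omega> \<bullet> w) = (\<Sum>i<k. \<Sum>j<k. v $ i * w $ j * (x \<omega> $ i * x \<omega> $ j))" if "\<omega> \<in> space P" for \<omega>
    using x[OF that] v w
    by (simp add: scalar_prod_def sum_product mult_ac lessThan_atLeast0)
  have int: "integrable P (\<lambda>\<omega>. x \<omega> $ i * x \<omega> $ j)" if "i < k" "j < k" for i j
    using mom that by (simp add: has_second_moments_def)
  have "integrable P (\<lambda>\<omega>. \<Sum>i<k. \<Sum>j<k. v $ i * w $ j * (x \<omega> $ i * x \<omega> $ j))"
    by (intro Bochner_Integration.integrable_sum integrable_mult_right int) auto
  then show "integrable P (\<lambda>\<omega>. (x \<omega> \<bullet> v) * (x \<omega> \<bullet> w))"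
    using e by (simp cong: Bochner_Integration.integrable_cong)
  have "(\<integral>\<omega>. (x \<omega> \<bullet> v) * (x \<omega> \<bullet> w) \<partial>P) = (\<integral>\<omega>. (\<Sum>i<k. \<Sum>j<k. v $ i * w $ j * (x \<omega> $ i * x \<omega> $ j)) \<partial>P)"
    by (rule Bochner_Integration.integral_cong) (simp_all add: e)
  also have "\<dots> = (\<Sum>i<k. \<Sum>j<k. v $ i * w $ j * (\<integral>\<omega>. x \<omega> $ i * x \<omega> $ j \<partial>P))"
    by (subst Bochner_Integration.integral_sum,
        force intro!: Bochner_Integration.integrable_sum integrable_mult_right int,
        intro sum.cong refl, subst Bochner_Integration.integral_sum)
      (auto intro!: integrable_mult_right int)
  also have "\<dots> = v \<bullet> (second_moment_mat P k x *\<^sub>v w)"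
    using v w by (simp add: second_moment_mat_def scalar_prod_def sum_distrib_left mult_ac lessThan_atLeast0)
  finally show "(\<integral>\<omega>. (x \<omega> \<bullet> v) * (x \<omega> \<bullet> w) \<partial>P) = v \<bullet> (second_moment_mat P k x *\<^sub>v w)" .
qed

section \<open>The best predictive model is the median probability model\<close>

theorem corollary4:
  fixes n k1 k2 :: nat
    and X1 X2 X Q Q1 :: "real mat" and y :: "real vec"
    and Ms :: "nat vec set" and Xl :: "nat vec \<Rightarrow> real mat"
    and p :: "nat vec \<Rightarrow> real" and \<pi> :: "nat vec \<Rightarrow> coeff_prior" and \<nu> :: "nat vec \<Rightarrow> real measure"
    and bc bn :: "nat vec \<Rightarrow> real vec"
    and P :: "'w measure" and x1 x2 x :: "'w \<Rightarrow> real vec" and R :: "nat vec \<Rightarrow> real"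
    and b \<gamma> :: real
  assumes dims: "X1 \<in> carrier_mat n k1" "X2 \<in> carrier_mat n k2" "y \<in> carrier_vec n"
    and X: "X = append_cols X1 X2" "k1 + k2 < n" "vec_space.rank n X = k1 + k2"
    and Q1: "Q1 = Q1_mat X1"
    and Ms: "Ms = nested_models k2"
    and Xl: "\<And>l. Xl l = X2 * H_mat l"
    and p: "\<And>l. l \<in> Ms \<Longrightarrow> p l \<ge> 0" "(\<Sum>l\<in>Ms. p l) = 1"
    and prior: "\<And>l. l \<in> Ms \<Longrightarrow> valid_prior k1 (model_size l) (\<pi> l) (\<nu> l)"
    and proper: "\<And>l. l \<in> Ms \<Longrightarrow> proper_posterior_with_means X1 (Xl l) y (\<pi> l) (\<nu> l)"
    and bc: "\<And>l. l \<in> Ms \<Longrightarrow> bc l = posterior_mean_common X1 (Xl l) y (\<pi> l) (\<nu> l)"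
    and bn: "\<And>l. l \<in> Ms \<Longrightarrow> bn l = posterior_mean_noncommon X1 (Xl l) y (\<pi> l) (\<nu> l)"
    and P: "prob_space P"
    and x: "random_vec P k1 x1" "random_vec P k2 x2" "\<And>\<omega>. x \<omega> = x1 \<omega> @\<^sub>v x2 \<omega>"
    and Q: "has_second_moments P (k1 + k2) x" "Q = second_moment_mat P (k1 + k2) x"
      "positive_definite Q"
    and R: "R = predictive_risk P Ms p (predictor x1 x2 bc bn)"
    and cond1: "\<gamma> > 0" "Q = \<gamma> \<cdot>\<^sub>m (X\<^sup>T * X)"
    and cond2: "b > 0"
      "\<And>l. l \<in> Ms \<Longrightarrow>
         bn l = b \<cdot>\<^sub>v (inv_mat ((Xl l)\<^sup>T * Q1 * Xl l) *\<^sub>v ((Xl l)\<^sup>T *\<^sub>v (Q1 *\<^sub>v y)))"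
    and cond3: "\<And>l. l \<in> Ms \<Longrightarrow> \<exists>\<pi>' :: real vec \<Rightarrow> real \<Rightarrow> real.
         \<forall>\<beta>1 \<in> carrier_vec k1. \<forall>\<beta>l \<in> carrier_vec (model_size l). \<forall>s>0. \<pi> l \<beta>1 \<beta>l s = \<pi>' \<beta>l s"
  shows "best_predictive_model R Ms (median_prob_model k2 Ms p) \<and>
    (\<exists>!j. nested_median_index k2 p j) \<and>
    (\<forall>j. nested_median_index k2 p j \<longrightarrow> best_predictive_model R Ms (nested_model k2 j))"
proof -
  define L where "L = nested_model k2"
  define q where "q i = p (L i)" for i
  define f where "f i = predictor x1 x2 bc bn (L i)" for i
  have L_in: "L j \<in> Ms" if "j \<le> k2" for j using that by (auto simp: Ms nested_models_eq L_def)
  have Ms_L: "Ms = L ` {..k2}" by (simp add: Ms nested_models_eq L_def)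
  have L_inj: "inj_on L {..k2}" unfolding L_def by (rule inj_nested_model)
  have sz: "model_size (L j) = j" if "j \<le> k2" for j using that by (simp add: L_def model_size_nested)
  have Hc: "H_mat (L j) \<in> carrier_mat k2 j" if "j \<le> k2" for j
    using that by (simp add: L_def H_mat_nested_carrier)
  have XlC: "Xl (L j) \<in> carrier_mat n j" if "j \<le> k2" for j
    unfolding Xl using dims(2) Hc[OF that] by simp
  have Xlv: "Xl (L j) *\<^sub>v v = X2 *\<^sub>v (H_mat (L j) *\<^sub>v v)" if "j \<le> k2" "v \<in> carrier_vec j" for j v
    unfolding Xl using dims(2) Hc that by (intro assoc_mult_mat_vec) auto
  have XC: "X \<in> carrier_mat n (k1 + k2)" unfolding X(1) by (rule append_cols_carrier[OF dims(1,2)])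
  have Xv: "X *\<^sub>v (a @\<^sub>v c) = X1 *\<^sub>v a + X2 *\<^sub>v c" if "a \<in> carrier_vec k1" "c \<in> carrier_vec k2" for a c
    unfolding X(1) by (rule append_cols_mult_append_vec[OF dims(1,2) that])

  (* Positive definiteness of Q = \<gamma> X\<^sup>T X makes X injective, which provides all inverses. *)
  have QC: "Q \<in> carrier_mat (k1 + k2) (k1 + k2)" unfolding Q(2) second_moment_mat_def by simp
  have X_inj: "full_column_rank X"
  proof (rule full_column_rankI[OF XC], rule ccontr)
    fix v assume v: "v \<in> carrier_vec (k1 + k2)" "X *\<^sub>v v = 0\<^sub>v n" "v \<noteq> 0\<^sub>v (k1 + k2)"
    have "v \<bullet> (Q *\<^sub>v v) > 0" using Q(3) QC v unfolding positive_definite_def by auto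
    moreover have "v \<bullet> (Q *\<^sub>v v) = \<gamma> * ((X *\<^sub>v v) \<bullet> (X *\<^sub>v v))"
      unfolding cond1(2) by (rule scaled_gram_bilinear[OF XC v(1,1)])
    ultimately show False using v(2) by simp
  qed
  have X1_X2_indep: "a = 0\<^sub>v k1 \<and> c = 0\<^sub>v k2"
    if a: "a \<in> carrier_vec k1" and c: "c \<in> carrier_vec k2" and 0: "X1 *\<^sub>v a + X2 *\<^sub>v c = 0\<^sub>v n" for a c
  proof -
    have "a @\<^sub>v c = 0\<^sub>v (k1 + k2)"
      using full_column_rankD[OF X_inj XC, of "a @\<^sub>v c"] Xv[OF a c] 0 a c by simp
    also have "\<dots> = 0\<^sub>v k1 @\<^sub>v 0\<^sub>v k2" by (intro eq_vecI) auto
    finally show ?thesis using a by (subst (asm) append_vec_eq[of _ k1]) auto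
  qed
  have X1_inj: "full_column_rank X1"
  proof (rule full_column_rankI[OF dims(1)])
    fix a assume a: "a \<in> carrier_vec k1" "X1 *\<^sub>v a = 0\<^sub>v n"
    have "X2 *\<^sub>v 0\<^sub>v k2 = 0\<^sub>v n" using dims(2) by (intro eq_vecI) auto
    then show "a = 0\<^sub>v k1" using X1_X2_indep[OF a(1), of "0\<^sub>v k2"] a(2) by simp
  qed
  have indep: "c = 0\<^sub>v j"
    if j: "j \<le> k2" and a: "a \<in> carrier_vec k1" and c: "c \<in> carrier_vec j" and eq: "X1 *\<^sub>v a = Xl (L j) *\<^sub>v c" for j a c
  proof -
    have Hv: "H_mat (L j) *\<^sub>v c \<in> carrier_vec k2" using Hc[OF j] c by simp
    have "X1 *\<^sub>v (- a) + X2 *\<^sub>v (H_mat (L j) *\<^sub>v c) = 0\<^sub>v n"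
    proof -
      have "X1 *\<^sub>v (- a) = - (X1 *\<^sub>v a)" using dims(1) a by (intro eq_vecI) auto
      also have "X1 *\<^sub>v a = X2 *\<^sub>v (H_mat (L j) *\<^sub>v c)" using eq Xlv[OF j c] by (rule trans)
      finally have "X1 *\<^sub>v (- a) = - (X2 *\<^sub>v (H_mat (L j) *\<^sub>v c))" .
      moreover have "X2 *\<^sub>v (H_mat (L j) *\<^sub>v c) \<in> carrier_vec n" using dims(2) Hv by simp
      ultimately show ?thesis by (simp only: uminus_l_inv_vec)
    qed
    then have "H_mat (L j) *\<^sub>v c = 0\<^sub>v k2" using X1_X2_indep[of "- a"] a Hv by simp
    then show ?thesis using H_mat_nested_injective[OF j c] by (simp add: L_def)
  qed

  have bnC: "bn (L j) \<in> carrier_vec j"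
    and bn_normal: "(Xl (L j))\<^sup>T *\<^sub>v (Q1 *\<^sub>v (Xl (L j) *\<^sub>v bn (L j))) = b \<cdot>\<^sub>v ((Xl (L j))\<^sup>T *\<^sub>v (Q1 *\<^sub>v y))"
    if j: "j \<le> k2" for j
  proof -
    have est: "bn (L j) = b \<cdot>\<^sub>v (inv_mat ((Xl (L j))\<^sup>T * Q1_mat X1 * Xl (L j)) *\<^sub>v
        ((Xl (L j))\<^sup>T *\<^sub>v (Q1_mat X1 *\<^sub>v y)))"
      using cond2(2)[OF L_in[OF j]] unfolding Q1 .
    note S = shrunken_ols_normal_equations[OF dims(1) X1_inj XlC[OF j] indep[OF j] dims(3) est]
    show "bn (L j) \<in> carrier_vec j" by (rule S(1))
    show "(Xl (L j))\<^sup>T *\<^sub>v (Q1 *\<^sub>v (Xl (L j) *\<^sub>v bn (L j))) = b \<cdot>\<^sub>v ((Xl (L j))\<^sup>T *\<^sub>v (Q1 *\<^sub>v y))"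
      unfolding Q1 by (rule S(2))
  qed
  note ols = ols_mat_normal_equations[OF dims(1) X1_inj]
  have bc_ols: "bc (L j) = ols_mat X1 *\<^sub>v (y - Xl (L j) *\<^sub>v bn (L j))" if j: "j \<le> k2" for j
  proof -
    obtain \<pi>' where "\<forall>\<beta>1 \<in> carrier_vec k1. \<forall>\<beta>l \<in> carrier_vec j. \<forall>s>0. \<pi> (L j) \<beta>1 \<beta>l s = \<pi>' \<beta>l s"
      using cond3[OF L_in[OF j]] sz[OF j] by auto
    note flat = this
    have vp: "valid_prior k1 j (\<pi> (L j)) (\<nu> (L j))" using prior[OF L_in[OF j]] sz[OF j] by simp
    show ?thesis
      unfolding bc[OF L_in[OF j]] bn[OF L_in[OF j]]
      by (rule posterior_mean_common_flat_prior[OF dims(1) XlC[OF j] dims(3) ols vp proper[OF L_in[OF j]] flat])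
  qed
  have bcC: "bc (L j) \<in> carrier_vec k1" if j: "j \<le> k2" for j
    unfolding bc[OF L_in[OF j]] posterior_mean_common_def using dims(1) by auto

  (* The coefficients of the full model that correspond to the estimates in model j. *)
  define \<beta> where "\<beta> j = bc (L j) @\<^sub>v (H_mat (L j) *\<^sub>v bn (L j))" for j
  have HbC: "H_mat (L j) *\<^sub>v bn (L j) \<in> carrier_vec k2" if "j \<le> k2" for j
    using Hc[OF that] bnC[OF that] by simp
  have \<beta>C: "\<beta> j \<in> carrier_vec (k1 + k2)" if "j \<le> k2" for j
    unfolding \<beta>_def using bcC[OF that] HbC[OF that] by simp
  have f_eq: "f j \<omega> = x \<omega> \<bullet> \<beta> j" if j: "j \<le> k2" and \<omega>: "\<omega> \<in> space P" for j \<omega>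
    unfolding f_def predictor_def x(3) \<beta>_def
    using x(1,2) \<omega> by (intro scalar_prod_append[symmetric, OF _ _ bcC[OF j] HbC[OF j]]) (auto simp: random_vec_def)
  have xC: "x \<omega> \<in> carrier_vec (k1 + k2)" if "\<omega> \<in> space P" for \<omega>
    using x(1,2) that unfolding x(3) random_vec_def by auto
  have fit: "X *\<^sub>v \<beta> j = X1 *\<^sub>v (ols_mat X1 *\<^sub>v (y - Xl (L j) *\<^sub>v bn (L j))) + Xl (L j) *\<^sub>v bn (L j)"
    if j: "j \<le> k2" for j
    using Xv[OF bcC[OF j] HbC[OF j]] unfolding \<beta>_def
    by (simp only: Xlv[OF j bnC[OF j], symmetric] bc_ols[OF j])

  have int: "integrable P (\<lambda>\<omega>. f i \<omega> * f j \<omega>)" if "i \<le> k2" "j \<le> k2" for i j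
  proof -
    have "integrable P (\<lambda>\<omega>. f i \<omega> * f j \<omega>) \<longleftrightarrow> integrable P (\<lambda>\<omega>. (x \<omega> \<bullet> \<beta> i) * (x \<omega> \<bullet> \<beta> j))"
      by (rule Bochner_Integration.integrable_cong) (simp_all add: f_eq that)
    then show ?thesis
      by (rule iffD2) (rule second_moment_bilinear(1)[OF xC Q(1) \<beta>C[OF that(1)] \<beta>C[OF that(2)]])
  qed
  (* The value of \<gamma> (X \<beta> i) \<bullet> (X \<beta> j) for i \<le> j, in which j does not occur. *)
  define g where "g i = \<gamma> * ((X1 *\<^sub>v (ols_mat X1 *\<^sub>v y)) \<bullet> (X1 *\<^sub>v (ols_mat X1 *\<^sub>v y))
      + b * ((Xl (L i) *\<^sub>v bn (L i)) \<bullet> (Q1 *\<^sub>v y)))" for i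
  have moment: "(\<integral>\<omega>. f i \<omega> * f j \<omega> \<partial>P) = g i" if ij: "i \<le> j" and j: "j \<le> k2" for i j
  proof -
    have i: "i \<le> k2" using ij j by simp
    obtain a where a: "a \<in> carrier_vec j" "H_mat (L i) *\<^sub>v bn (L i) = H_mat (L j) *\<^sub>v a"
      using H_mat_nested_range_mono[OF ij j bnC[OF i]] unfolding L_def by metis
    (* The column spaces are nested: the larger model can represent the noncommon part of the
      smaller one, with coefficients a. *)
    have Xa: "Xl (L i) *\<^sub>v bn (L i) = Xl (L j) *\<^sub>v a"
      using Xlv[OF i bnC[OF i]] Xlv[OF j a(1)] a(2) by simp
    have "(\<integral>\<omega>. f i \<omega> * f j \<omega> \<partial>P) = (\<integral>\<omega>. (x \<omega> \<bullet> \<beta> i) * (x \<omega> \<bullet> \<beta> j) \<partial>P)"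
      by (rule Bochner_Integration.integral_cong) (simp_all add: f_eq i j)
    also have "\<dots> = \<beta> i \<bullet> (Q *\<^sub>v \<beta> j)"
      unfolding Q(2) by (rule second_moment_bilinear(2)[OF xC Q(1) \<beta>C[OF i] \<beta>C[OF j]])
    also have "\<dots> = \<gamma> * ((X *\<^sub>v \<beta> i) \<bullet> (X *\<^sub>v \<beta> j))"
      unfolding cond1(2) by (rule scaled_gram_bilinear[OF XC \<beta>C[OF i] \<beta>C[OF j]])
    also have "\<dots> = g i"
      unfolding fit[OF i] fit[OF j] g_def Xa Q1
      by (subst fitted_values_inner_nested[OF dims(1) X1_inj XlC[OF j] bnC[OF j] a(1) dims(3) bn_normal[OF j, unfolded Q1]]) simp
    finally show ?thesis .
  qed

  have sum_Ms: "(\<Sum>l\<in>Ms. F l) = (\<Sum>i\<le>k2. F (L i))" for F :: "nat vec \<Rightarrow> real"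
    unfolding Ms_L by (simp add: sum.reindex[OF L_inj])
  have R_L: "R (L j) = (\<integral>\<omega>. (f j \<omega> - (\<Sum>i\<le>k2. q i * f i \<omega>))\<^sup>2 \<partial>P)" for j
    unfolding R predictive_risk_def sum_Ms f_def q_def ..
  have q1: "(\<Sum>i\<le>k2. q i) = 1" using p(2) unfolding sum_Ms q_def .
  have q0: "q i \<ge> 0" if "i \<le> k2" for i unfolding q_def by (rule p(1)[OF L_in[OF that]])
  have best: "best_predictive_model R Ms (L j)"
    if j: "j \<le> k2" "\<And>i. i < j \<Longrightarrow> (\<Sum>m\<in>{i<..k2}. q m) \<ge> 1/2"
      "\<And>i. j \<le> i \<Longrightarrow> i < k2 \<Longrightarrow> (\<Sum>m\<in>{i<..k2}. q m) \<le> 1/2" for j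
  proof -
    have "R (L j) \<le> R (L a)" if "a \<le> k2" for a
      unfolding R_L
      by (rule orthogonal_increments_risk_minimum[where f = f and g = g, OF int moment j that])
    then show ?thesis
      using L_in[OF j(1)] unfolding best_predictive_model_def is_arg_min_def Ms_L
      by (auto simp: not_less)
  qed

  have "best_predictive_model R Ms (median_prob_model k2 Ms p)"
  proof -
    obtain j where j: "j \<le> k2" "median_prob_model k2 (nested_models k2) p = L j"
      "\<forall>i<j. (\<Sum>m\<in>{i<..k2}. q m) \<ge> 1/2"
      "\<forall>i. j \<le> i \<and> i < k2 \<longrightarrow> (\<Sum>m\<in>{i<..k2}. q m) < 1/2"
      using median_prob_model_nested[of k2 p] p(1) unfolding Ms q_def L_def by blast
    have "best_predictive_model R Ms (L j)"
      by (rule best) (use j in \<open>auto intro: less_imp_le\<close>)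
    then show ?thesis unfolding Ms j(2) .
  qed
  moreover have "\<exists>!j. nested_median_index k2 p j"
    unfolding nested_median_index_def L_def[symmetric] q_def[symmetric] by (rule ex1_median_index[OF q0 q1])
  moreover have "best_predictive_model R Ms (nested_model k2 j)" if "nested_median_index k2 p j" for j
  proof -
    have j: "j \<le> k2" "(\<Sum>i<j. q i) < 1/2" "(\<Sum>i\<le>j. q i) \<ge> 1/2"
      using that unfolding nested_median_index_def q_def L_def by auto
    (* Partial and tail sums of q add up to 1, so the two inequalities for the partial sums at j
      become the two inequalities for the tail sums on either side of j. *)
    have tail_ge: "(\<Sum>m\<in>{i<..k2}. q m) \<ge> 1/2" if "i < j" for i
    proof -
      have "(\<Sum>m\<le>i. q m) \<le> (\<Sum>m<j. q m)" by (rule sum_mono2) (use that j(1) q0 in auto)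
      then show ?thesis using sum_tail_eq_diff[OF q1, of i] that j by simp
    qed
    have tail_le: "(\<Sum>m\<in>{i<..k2}. q m) \<le> 1/2" if "j \<le> i" "i < k2" for i
    proof -
      have "(\<Sum>m\<le>j. q m) \<le> (\<Sum>m\<le>i. q m)" by (rule sum_mono2) (use that q0 in auto)
      then show ?thesis using sum_tail_eq_diff[OF q1, of i] that j by simp
    qed
    show ?thesis using best[OF j(1) tail_ge tail_le] unfolding L_def .
  qed
  ultimately show ?thesis by blast
qed

end
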